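(* Let $n\ge 3$ be an integer, let $H:\mathbb{R}\to\mathbb{R}$ be a continuous function, and fix $s_0\in\mathbb{R}$. Then, for any $c>0$ and any real numbers $c',d'$ with $c'^2+d'^2=1$, there exists a global solution curve $(x(s),y(s))$, $s\in\mathbb{R}$, of the system $$(n-1)H(s)=(n-2)\frac{x'(s)}{y(s)}+x''(s)y'(s)-x'(s)y''(s),\qquad x'(s)^2+y'(s)^2=1,$$ with the initial conditions $x(s_0)=0$, $y(s_0)=c$, $x'(s_0)=c'$, $y'(s_0)=d'$.
   Context: The system describes generating curves, parametrized by arc length, of rotational hypersurfaces $\{(x(s),y(s)\omega): s\in\mathbb{R},\ \omega\in S^{n-2}\}\subset\mathbb{R}^n$ with mean curvature $H(s)$. Global solution curve: a pair of functions $x,y\in C^1(\mathbb{R})$ with $x'^2+y'^2=1$ on all of $\mathbb{R}$, such that $x,y$ are of class $C^2$ on the open set $\{s: y(s)\neq 0\}$ and the first equation of the system holds at every $s$ with $y(s)\ne 0$. When the curve reaches the $x$-axis ($y=0$) it is continued as a $C^1$ curve into the region $y<0$ (the generating curve of the hypersurface is then obtained by reflecting the part with $y<0$ in the $x$-axis). *)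

theory Defs
  imports "HOL-Analysis.Analysis"
begin

definition C2_differentiable_on :: "(real \<Rightarrow> real) \<Rightarrow> real set \<Rightarrow> bool"
    (infix "C2'_differentiable'_on" 50) where
  "f C2_differentiable_on U \<longleftrightarrow>
     f C1_differentiable_on U \<and> deriv f C1_differentiable_on U"

text \<open>
  The curve \<open>(x, y)\<close> generates a rotational hypersurface in \<open>n\<close>-dimensional Euclidean space
  with mean curvature \<open>H\<close>.  The curve is \<open>C\<^sup>1\<close> and parametrized by arc length on the whole
  real line, also across the axis \<open>y = 0\<close>; the curvature equation and \<open>C\<^sup>2\<close> regularity are
  required only off the axis, where \<open>y\<close> may have either sign.
\<close>

definition global_solution_curve ::
    "nat \<Rightarrow> (real \<Rightarrow> real) \<Rightarrow> (real \<Rightarrow> real) \<Rightarrow> (real \<Rightarrow> real) \<Rightarrow> bool" where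
  "global_solution_curve n H x y \<longleftrightarrow>
     x C1_differentiable_on UNIV \<and> y C1_differentiable_on UNIV \<and>
     (\<forall>s. (deriv x s)\<^sup>2 + (deriv y s)\<^sup>2 = 1) \<and>
     x C2_differentiable_on {s. y s \<noteq> 0} \<and> y C2_differentiable_on {s. y s \<noteq> 0} \<and>
     (\<forall>s. y s \<noteq> 0 \<longrightarrow>
        (real n - 1) * H s =
          (real n - 2) * (deriv x s / y s)
          + deriv (deriv x) s * deriv y s - deriv x s * deriv (deriv y) s)"

end

(*
  Write p = x', q = y', m = n - 2, h = (n - 1) H. Off the axis the system reads y' = q,
  p' = - q w, q' = p w with w = m p / y - h, on the unit circle p^2 + q^2 = 1.
  A solution that starts on the axis with p = 0 satisfies the conservation law
  (y^m p)' = h y^m q, which turns into the fixed-point equation p = y^(-m) * integral h y^m q,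
  a contraction on a short interval; off the axis the angle of (p, q) solves a contractive
  integral equation. What remains is that a solution cannot break down at a finite parameter b.
  If y tends to a nonzero limit this is clear. If y tends to 0, then (y q)' = q^2 + m p^2 - h y p
  >= 1 - K |y|, also across zeros of y; integrating up to b, where y q vanishes, gives
  |y q| >= (b - s) (1 - K (b - s)), and since |y| <= b - s this forces |q| -> 1 and p -> 0,
  which are the data of a solution starting on the axis.
*)
theory Submission
  imports Defs
begin

text \<open>\<open>h\<close> depends on the parameter \<open>s\<close> alone: it cancels from the
  differences estimated off the axis and is a bounded factor in those on the axis. Hence continuity
  of \<open>H\<close> is enough, without a Lipschitz condition. The unknown changes at the axis
  because the term \<open>m p / y\<close> has no bound there in terms of the angle. The weight
  \<open>y^m\<close> is its integrating factor: once it is used, only quotients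
  \<open>y(t) / y(s)\<close> with \<open>t\<close> before \<open>s\<close> remain, and these lie
  between 0 and 1. No uniqueness is proved, so local solutions cannot be joined by comparing them on
  overlaps. Each solution is prolonged as it stands, and a maximal prolongation is taken by Zorn's
  lemma. At a finite end point the obstacle is that zeros of \<open>y\<close> might accumulate
  there, so that there need not be a last interval on which \<open>y\<close> has one sign. The
  product \<open>y q\<close> is the quantity that can be followed through these zeros, where no
  equation for \<open>q\<close> is available.\<close>

section \<open>Fixed points, derivatives and extension of solutions\<close>

text \<open>Picard iteration in the supremum distance, phrased for plain functions: \<open>M\<close>
  runs through all bounds of the distance on \<open>S\<close>, so no space of continuous functions
  has to be formed. Halving makes the increments of the iterates geometric, and the Weierstrass test
  sums them uniformly.\<close>

lemma uniform_contraction_fixpoint: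
  fixes T :: "('a::topological_space \<Rightarrow> 'b::banach) \<Rightarrow> 'a \<Rightarrow> 'b"
  assumes S: "compact S" and B: "closed B"
    and f0: "continuous_on S f0" "f0 ` S \<subseteq> B"
    and cont: "\<And>f. continuous_on S f \<Longrightarrow> f ` S \<subseteq> B \<Longrightarrow> continuous_on S (T f)"
    and maps: "\<And>f. continuous_on S f \<Longrightarrow> f ` S \<subseteq> B \<Longrightarrow> T f ` S \<subseteq> B"
    and contr: "\<And>f g M s. continuous_on S f \<Longrightarrow> f ` S \<subseteq> B \<Longrightarrow> continuous_on S g \<Longrightarrow> g ` S \<subseteq> B \<Longrightarrow>
      (\<And>t. t \<in> S \<Longrightarrow> norm (f t - g t) \<le> M) \<Longrightarrow> s \<in> S \<Longrightarrow> norm (T f s - T g s) \<le> M / 2"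
  obtains f where "continuous_on S f" "f ` S \<subseteq> B" "\<And>s. s \<in> S \<Longrightarrow> T f s = f s"
proof -
  define F where "F n = (T ^^ n) f0" for n
  have F_Suc: "F (Suc n) = T (F n)" for n by (simp add: F_def)
  have F: "continuous_on S (F n) \<and> F n ` S \<subseteq> B" for n
  proof (induction n)
    case 0
    then show ?case using f0 by (simp add: F_def)
  next
    case (Suc n)
    then show ?case unfolding F_Suc using cont maps by blast
  qed
  have "compact ((\<lambda>s. F 1 s - F 0 s) ` S)"
    using F S by (intro compact_continuous_image continuous_intros) auto
  then obtain M where M: "\<And>s. s \<in> S \<Longrightarrow> norm (F 1 s - F 0 s) \<le> M"
    using compact_imp_bounded bounded_iff by (metis (no_types, lifting) imageI)
  have step: "\<forall>s\<in>S. norm (F (Suc n) s - F n s) \<le> M * (1/2) ^ n" for n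
  proof (induction n)
    case 0
    then show ?case using M by simp
  next
    case (Suc n)
    show ?case
    proof
      fix s assume "s \<in> S"
      then have "norm (T (F (Suc n)) s - T (F n) s) \<le> M * (1/2) ^ n / 2"
        using F Suc by (intro contr) auto
      then show "norm (F (Suc (Suc n)) s - F (Suc n) s) \<le> M * (1/2) ^ Suc n"
        by (simp add: F_Suc[of "Suc n"] F_Suc[of n])
    qed
  qed
  define L where "L s = F 0 s + (\<Sum>i. F (Suc i) s - F i s)" for s
  have "uniform_limit S (\<lambda>n s. \<Sum>i<n. F (Suc i) s - F i s) (\<lambda>s. \<Sum>i. F (Suc i) s - F i s) sequentially"
    by (rule Weierstrass_m_test[where M = "\<lambda>n. M * (1/2) ^ n"])
      (use step in \<open>auto intro!: summable_mult summable_geometric\<close>)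
  then have "uniform_limit S (\<lambda>n s. F 0 s + (\<Sum>i<n. F (Suc i) s - F i s)) L sequentially"
    unfolding L_def by (intro uniform_limit_intros)
  moreover have "F 0 s + (\<Sum>i<n. F (Suc i) s - F i s) = F n s" for n s
    by (simp add: sum_lessThan_telescope[of "\<lambda>i. F i s"])
  ultimately have lim: "uniform_limit S F L sequentially" by simp
  have L_cont: "continuous_on S L"
    by (rule uniform_limit_theorem[OF _ lim]) (use F in auto)
  have L_B: "L ` S \<subseteq> B"
  proof safe
    fix s assume s: "s \<in> S"
    show "L s \<in> B"
      by (rule Lim_in_closed_set[OF B _ _ tendsto_uniform_limitI[OF lim s]])
        (use F s in \<open>auto simp: image_subset_iff\<close>)
  qed
  have "T L s = L s" if s: "s \<in> S" for s
  proof -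
    \<comment> \<open>Applied to the pair \<open>F n\<close>, \<open>L\<close>, the contraction
      property doubles as continuity of \<open>T\<close> at the limit.\<close>
    have "(\<lambda>n. F (Suc n) s) \<longlonglongrightarrow> T L s"
    proof (rule LIMSEQ_I)
      fix e :: real assume e: "e > 0"
      then obtain N where N: "\<And>n t. n \<ge> N \<Longrightarrow> t \<in> S \<Longrightarrow> dist (F n t) (L t) < e"
        using lim unfolding uniform_limit_iff eventually_sequentially by metis
      have "norm (F (Suc n) s - T L s) < e" if "n \<ge> N" for n
      proof -
        have "norm (F (Suc n) s - T L s) \<le> e / 2"
          unfolding F_Suc using F L_cont L_B N[OF that] s
          by (intro contr) (auto simp: dist_norm intro: less_imp_le)
        then show ?thesis using e by linarith
      qed
      then show "\<exists>N. \<forall>n\<ge>N. norm (F (Suc n) s - T L s) < e" by blast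
    qed
    moreover have "(\<lambda>n. F (Suc n) s) \<longlonglongrightarrow> L s"
      using tendsto_uniform_limitI[OF lim s] by (rule LIMSEQ_Suc)
    ultimately show ?thesis by (rule LIMSEQ_unique)
  qed
  with L_cont L_B that show thesis by blast
qed

lemma integral_has_real_derivative_interior:
  fixes g :: "real \<Rightarrow> real"
  assumes g: "continuous_on {a..b} g" and s: "s \<in> {a<..<b}"
  shows "((\<lambda>t. integral {a..t} g) has_real_derivative g s) (at s)"
proof -
  have "((\<lambda>t. integral {a..t} g) has_real_derivative g s) (at s within {a..b})"
    using s by (intro integral_has_real_derivative g) auto
  moreover have "at s within {a..b} = at s"
    using s by (intro at_within_interior) auto
  ultimately show ?thesis by simp
qed

text \<open>The fundamental theorem of calculus tolerates finitely many exceptional points, so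
  \<open>f\<close> is \<open>f a\<close> plus an integral of \<open>g\<close>; continuity of
  \<open>g\<close> then gives the derivative at the exceptional points as well.\<close>

lemma has_real_derivative_removable:
  fixes f g :: "real \<Rightarrow> real"
  assumes "finite K" and f: "continuous_on {a..b} f" and g: "continuous_on {a..b} g"
    and der: "\<And>s. s \<in> {a<..<b} - K \<Longrightarrow> (f has_real_derivative g s) (at s)"
    and s: "s \<in> {a<..<b}"
  shows "(f has_real_derivative g s) (at s)"
proof -
  have "f t = f a + integral {a..t} g" if "t \<in> {a<..<b}" for t
  proof -
    have "(g has_integral f t - f a) {a..t}"
      by (rule fundamental_theorem_of_calculus_interior_strong[OF \<open>finite K\<close>])
        (use that der in \<open>auto intro: continuous_on_subset[OF f]
          simp: has_real_derivative_iff_has_vector_derivative[symmetric]\<close>)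
    then show ?thesis by (simp add: integral_unique)
  qed
  moreover have "((\<lambda>t. f a + integral {a..t} g) has_real_derivative g s) (at s)"
    using integral_has_real_derivative_interior[OF g s] by (auto intro!: derivative_eq_intros)
  ultimately show ?thesis
    by (subst has_field_derivative_cong_eventually[where g = "\<lambda>t. f a + integral {a..t} g"])
      (use s in \<open>auto intro!: eventually_at_in_open' elim!: eventually_mono[rotated]
        intro: eventually_mono[OF eventually_at_in_open'[of "{a<..<b}" s]]\<close>)
qed

text \<open>Read \<open>R b f\<close> as: \<open>f\<close> solves the problem on
  \<open>{a..b}\<close>. Solutions need not be unique, so choices made at different stages must be
  kept compatible; ordering solutions by inclusion of graphs achieves this.\<close>

lemma extension_to_half_line:
  fixes R :: "real \<Rightarrow> (real \<Rightarrow> 'a) \<Rightarrow> bool"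
  assumes local: "\<And>b f g. R b f \<Longrightarrow> (\<And>s. s \<in> {a..b} \<Longrightarrow> g s = f s) \<Longrightarrow> R b g"
    and restrict: "\<And>b c f. R b f \<Longrightarrow> a \<le> c \<Longrightarrow> c \<le> b \<Longrightarrow> R c f"
    and init: "R a f0"
    and step: "\<And>b f. a \<le> b \<Longrightarrow> R b f \<Longrightarrow> \<exists>c>b. \<exists>g. R c g \<and> (\<forall>s\<in>{a..b}. g s = f s)"
    and limit: "\<And>b f. a < b \<Longrightarrow> (\<And>c. a \<le> c \<Longrightarrow> c < b \<Longrightarrow> R c f) \<Longrightarrow>
      \<exists>g. R b g \<and> (\<forall>s\<in>{a..<b}. g s = f s)"
  obtains f where "f a = f0 a" "\<And>b. a \<le> b \<Longrightarrow> R b f"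
proof -
  \<comment> \<open>Zorn's lemma for the graphs of solutions, ordered by inclusion.\<close>
  define gr where "gr I f = (\<lambda>s. (s, f s)) ` I" for I :: "real set" and f :: "real \<Rightarrow> 'a"
  \<comment> \<open>\<open>I\<close> is an initial segment of the half-line from \<open>a\<close>.
    Values of \<open>f\<close> outside \<open>I\<close> are arbitrary, which is why graphs over
    \<open>I\<close> are compared and not functions.\<close>
  define sol where "sol I f \<longleftrightarrow> a \<in> I \<and> (\<forall>s\<in>I. a \<le> s \<and> {a..s} \<subseteq> I \<and> R s f) \<and> f a = f0 a"
    for I f
  define A where "A = {gr I f | I f. sol I f}"
  have "sol {a} f0" using init by (auto simp: sol_def)
  then have "A \<noteq> {}" by (auto simp: A_def)
  moreover have "\<Union>C \<in> A" if C: "C \<noteq> {}" "subset.chain A C" for C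
  proof -
    define I where "I = fst ` \<Union>C"
    define f where "f s = (SOME v. (s, v) \<in> \<Union>C)" for s
    have uniq: "v = w" if "(s, v) \<in> \<Union>C" "(s, w) \<in> \<Union>C" for s v w
    proof -
      obtain G G' where G: "G \<in> C" "G' \<in> C" "(s, v) \<in> G" "(s, w) \<in> G'"
        using \<open>(s, v) \<in> \<Union>C\<close> \<open>(s, w) \<in> \<Union>C\<close> by blast
      then have "G \<subseteq> G' \<or> G' \<subseteq> G" "G \<in> A" "G' \<in> A"
        using C by (auto simp: subset_chain_def)
      then show ?thesis using G by (auto simp: A_def gr_def)
    qed
    have f_eq: "f s = v" if "(s, v) \<in> \<Union>C" for s v
      unfolding f_def using that by (rule someI2) (rule uniq[OF _ that])
    have member: "\<exists>J g. sol J g \<and> s \<in> J \<and> J \<subseteq> I \<and> (\<forall>t\<in>J. f t = g t)" if "s \<in> I" for s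
    proof -
      obtain v G where G: "G \<in> C" "(s, v) \<in> G" using \<open>s \<in> I\<close> by (auto simp: I_def)
      then have "G \<in> A" using C by (auto simp: subset_chain_def)
      then obtain J g where J: "sol J g" "G = gr J g" by (auto simp: A_def)
      have "(t, g t) \<in> \<Union>C" if "t \<in> J" for t
        using that G J by (auto simp: gr_def)
      then have "J \<subseteq> I" "\<forall>t\<in>J. f t = g t"
        using f_eq by (force simp: I_def)+
      moreover have "s \<in> J" using G J by (auto simp: gr_def)
      ultimately show ?thesis using J by blast
    qed
    have "\<Union>C = gr I f"
      using f_eq by (force simp: gr_def I_def)
    moreover have "sol I f"
    proof -
      obtain G where "G \<in> C" "G \<in> A" using C by (auto simp: subset_chain_def)
      then obtain J g where "sol J g" "gr J g \<in> C" by (auto simp: A_def)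
      moreover from this have "(a, f0 a) \<in> gr J g" by (auto simp: sol_def gr_def)
      ultimately have *: "(a, f0 a) \<in> \<Union>C" by blast
      then have "fst (a, f0 a) \<in> I" unfolding I_def by (rule imageI)
      with f_eq[OF *] have "a \<in> I \<and> f a = f0 a" by simp
      moreover have "a \<le> s \<and> {a..s} \<subseteq> I \<and> R s f" if "s \<in> I" for s
      proof -
        obtain J g where J: "sol J g" "s \<in> J" "J \<subseteq> I" "\<forall>t\<in>J. f t = g t"
          using member[OF \<open>s \<in> I\<close>] by blast
        then have "R s g" "{a..s} \<subseteq> J" "a \<le> s" by (auto simp: sol_def)
        then show ?thesis using J by (auto intro!: local[of s g])
      qed
      ultimately show ?thesis by (simp add: sol_def)
    qed
    ultimately show ?thesis by (auto simp: A_def)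
  qed
  ultimately obtain G where "G \<in> A" and G_max: "\<And>X. X \<in> A \<Longrightarrow> G \<subseteq> X \<Longrightarrow> X = G"
    using subset_Zorn_nonempty[of A] by blast
  then obtain I f where sol: "sol I f" and G: "G = gr I f" by (auto simp: A_def)
  have maximal: "J = I" if "sol J g" "I \<subseteq> J" "\<And>s. s \<in> I \<Longrightarrow> g s = f s" for J g
  proof -
    have "G \<subseteq> gr J g" using that by (force simp: G gr_def)
    then have "gr J g = gr I f" using G_max that G by (auto simp: A_def)
    then have "fst ` gr J g = fst ` gr I f" by simp
    then show ?thesis by (simp add: gr_def image_image)
  qed
  have solI: "sol {a..c} g" if "a \<le> c" "R c g" "g a = f0 a" for c g
    using that by (auto simp: sol_def intro: restrict)
  have "b \<in> I" if "a \<le> b" for b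
  proof (rule ccontr)
    assume "b \<notin> I"
    then have bound: "s < b" if "s \<in> I" for s
      using sol that \<open>a \<le> b\<close> unfolding sol_def by (metis atLeastAtMost_iff not_le subsetD)
    define e where "e = Sup I"
    have bdd: "bdd_above I" using bound by (meson bdd_aboveI less_imp_le)
    have aI: "a \<in> I" and fa: "f a = f0 a" using sol by (auto simp: sol_def)
    have le_e: "s \<le> e" if "s \<in> I" for s
      unfolding e_def using that bdd by (rule cSup_upper)
    have below_e: "s \<in> I" if "a \<le> s" "s < e" for s
    proof -
      obtain t where "t \<in> I" "s < t"
        using \<open>s < e\<close> less_cSup_iff[of I s] bdd aI by (auto simp: e_def)
      then show ?thesis using sol \<open>a \<le> s\<close> by (force simp: sol_def)
    qed
    show False
    \<comment> \<open>A bounded maximal domain is \<open>{a..e}\<close> or \<open>{a..<e}\<close>.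
      Assumption \<open>step\<close> prolongs the first beyond \<open>e\<close>, assumption
      \<open>limit\<close> adds \<open>e\<close> to the second; either contradicts
      maximality.\<close>
    proof (cases "e \<in> I")
      case True
      then have "R e f" "a \<le> e" "{a..e} \<subseteq> I" using sol by (auto simp: sol_def)
      then obtain c g where c: "c > e" "R c g" "\<forall>s\<in>{a..e}. g s = f s" using step by blast
      have I: "I = {a..e}" using \<open>{a..e} \<subseteq> I\<close> le_e sol by (auto simp: sol_def)
      have "{a..c} = I"
        using c \<open>a \<le> e\<close> fa by (intro maximal[of _ g] solI) (auto simp: I)
      then show False using c \<open>a \<le> e\<close> I by auto
    next
      case False
      then have "a < e" using le_e[OF aI] aI by (metis less_eq_real_def)
      moreover have "R c f" if "a \<le> c" "c < e" for c
        using below_e[OF that] sol by (auto simp: sol_def)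
      ultimately obtain g where g: "R e g" "\<forall>s\<in>{a..<e}. g s = f s" using limit by blast
      have I: "I = {a..<e}"
      proof (intro set_eqI iffI)
        fix s assume "s \<in> I"
        then have "a \<le> s" "s \<le> e" "s \<noteq> e" using sol False le_e by (auto simp: sol_def)
        then show "s \<in> {a..<e}" by simp
      qed (use below_e in simp)
      have "{a..e} = I"
        using g \<open>a < e\<close> fa by (intro maximal[of _ g] solI) (auto simp: I)
      then show False using \<open>a < e\<close> I by auto
    qed
  qed
  then have "R b f" if "a \<le> b" for b using sol that by (auto simp: sol_def)
  moreover have "f a = f0 a" using sol by (simp add: sol_def)
  ultimately show thesis using that by blast
qed

section \<open>The first-order system\<close>

text \<open>
  Here \<open>p = x'\<close> and \<open>q = y'\<close>. Differential equations are imposed at interior points only, so that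
  solutions can be glued; they hold at the gluing points by \<open>has_real_derivative_removable\<close>.
  Requiring \<open>p = 0\<close> on the axis is not part of the original problem: it is what allows a
  solution that ends on the axis to be continued.
\<close>

definition profile_on :: "(real \<Rightarrow> real) \<Rightarrow> nat \<Rightarrow> real \<Rightarrow> real \<Rightarrow>
    (real \<Rightarrow> real) \<Rightarrow> (real \<Rightarrow> real) \<Rightarrow> (real \<Rightarrow> real) \<Rightarrow> bool" where
  "profile_on h m a b p q y \<longleftrightarrow>
     continuous_on {a..b} p \<and> continuous_on {a..b} q \<and> continuous_on {a..b} y \<and>
     (\<forall>s\<in>{a..b}. (p s)\<^sup>2 + (q s)\<^sup>2 = 1) \<and> (\<forall>s\<in>{a..b}. y s = 0 \<longrightarrow> p s = 0) \<and>
     (\<forall>s\<in>{a<..<b}. (y has_real_derivative q s) (at s)) \<and>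
     (\<forall>s\<in>{a<..<b}. y s \<noteq> 0 \<longrightarrow>
        (p has_real_derivative - q s * (m * p s / y s - h s)) (at s)) \<and>
     (\<forall>s\<in>{a<..<b}. y s \<noteq> 0 \<longrightarrow>
        (q has_real_derivative p s * (m * p s / y s - h s)) (at s))"

lemma profile_onI:
  assumes "continuous_on {a..b} p" "continuous_on {a..b} q" "continuous_on {a..b} y"
    and "\<And>s. s \<in> {a..b} \<Longrightarrow> (p s)\<^sup>2 + (q s)\<^sup>2 = 1"
    and "\<And>s. s \<in> {a..b} \<Longrightarrow> y s = 0 \<Longrightarrow> p s = 0"
    and "\<And>s. s \<in> {a<..<b} \<Longrightarrow> (y has_real_derivative q s) (at s)"
    and "\<And>s. s \<in> {a<..<b} \<Longrightarrow> y s \<noteq> 0 \<Longrightarrow>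
      (p has_real_derivative - q s * (m * p s / y s - h s)) (at s)"
    and "\<And>s. s \<in> {a<..<b} \<Longrightarrow> y s \<noteq> 0 \<Longrightarrow>
      (q has_real_derivative p s * (m * p s / y s - h s)) (at s)"
  shows "profile_on h m a b p q y"
  using assms unfolding profile_on_def by blast

lemma profile_onD:
  assumes "profile_on h m a b p q y"
  shows "continuous_on {a..b} p" "continuous_on {a..b} q" "continuous_on {a..b} y"
    and "\<And>s. s \<in> {a..b} \<Longrightarrow> (p s)\<^sup>2 + (q s)\<^sup>2 = 1"
    and "\<And>s. s \<in> {a..b} \<Longrightarrow> y s = 0 \<Longrightarrow> p s = 0"
    and "\<And>s. s \<in> {a<..<b} \<Longrightarrow> (y has_real_derivative q s) (at s)"
    and "\<And>s. s \<in> {a<..<b} \<Longrightarrow> y s \<noteq> 0 \<Longrightarrow>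
      (p has_real_derivative - q s * (m * p s / y s - h s)) (at s)"
    and "\<And>s. s \<in> {a<..<b} \<Longrightarrow> y s \<noteq> 0 \<Longrightarrow>
      (q has_real_derivative p s * (m * p s / y s - h s)) (at s)"
  using assms unfolding profile_on_def by blast+

lemma profile_on_cong:
  assumes prof: "profile_on h m a b p q y"
    and p: "\<And>s. s \<in> {a..b} \<Longrightarrow> p' s = p s" and q: "\<And>s. s \<in> {a..b} \<Longrightarrow> q' s = q s"
    and y: "\<And>s. s \<in> {a..b} \<Longrightarrow> y' s = y s"
  shows "profile_on h m a b p' q' y'"
proof -
  have d: "(f has_real_derivative d) (at s)"
    if "s \<in> {a<..<b}" "\<And>t. t \<in> {a..b} \<Longrightarrow> f t = g t" "(g has_real_derivative d) (at s)"
    for s d and f g :: "real \<Rightarrow> real"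
  proof -
    have "\<forall>\<^sub>F t in nhds s. t \<in> {a<..<b}" using that by (intro eventually_nhds_in_open) auto
    then have "\<forall>\<^sub>F t in nhds s. f t = g t" by (rule eventually_mono) (use that in auto)
    from DERIV_cong_ev[OF refl this refl] that show ?thesis by blast
  qed
  have sub: "s \<in> {a..b}" if "s \<in> {a<..<b}" for s using that by auto
  show ?thesis
  proof (rule profile_onI)
    show "continuous_on {a..b} p'" "continuous_on {a..b} q'" "continuous_on {a..b} y'"
      using profile_onD(1-3)[OF prof] continuous_on_eq p q y by metis+
  next
    fix s assume s: "s \<in> {a<..<b}"
    show "(y' has_real_derivative q' s) (at s)"
      unfolding q[OF sub[OF s]] using s y profile_onD(6)[OF prof s] by (rule d)
    assume "y' s \<noteq> 0"
    then have ys: "y s \<noteq> 0" by (simp add: y[OF sub[OF s]])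
    show "(p' has_real_derivative - q' s * (m * p' s / y' s - h s)) (at s)"
      unfolding p[OF sub[OF s]] q[OF sub[OF s]] y[OF sub[OF s]]
      using s p profile_onD(7)[OF prof s ys] by (rule d)
    show "(q' has_real_derivative p' s * (m * p' s / y' s - h s)) (at s)"
      unfolding p[OF sub[OF s]] q[OF sub[OF s]] y[OF sub[OF s]]
      using s q profile_onD(8)[OF prof s ys] by (rule d)
  next
    fix s assume s: "s \<in> {a..b}"
    show "(p' s)\<^sup>2 + (q' s)\<^sup>2 = 1" unfolding p[OF s] q[OF s] by (rule profile_onD(4)[OF prof s])
    show "p' s = 0" if "y' s = 0"
      using that unfolding p[OF s] y[OF s] by (rule profile_onD(5)[OF prof s])
  qed
qed

lemma profile_on_subset:
  assumes prof: "profile_on h m a b p q y" and "a \<le> a'" "b' \<le> b"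
  shows "profile_on h m a' b' p q y"
proof -
  have sub: "{a'..b'} \<subseteq> {a..b}" "{a'<..<b'} \<subseteq> {a<..<b}" using assms by auto
  show ?thesis
    using continuous_on_subset[OF profile_onD(1)[OF prof] sub(1)]
      continuous_on_subset[OF profile_onD(2)[OF prof] sub(1)]
      continuous_on_subset[OF profile_onD(3)[OF prof] sub(1)]
    by (rule profile_onI) (use sub profile_onD(4-8)[OF prof] in blast)+
qed

text \<open>Reversing the parameter alone changes the sign of \<open>p\<close> and with it the sign
  of \<open>h\<close>. Combined with the reflection of \<open>x\<close>, that is, passing to
  \<open>- x (- s)\<close>, it keeps the sign of both. This yields backward solutions from forward
  ones.\<close>

lemma profile_on_reflect:
  assumes prof: "profile_on h m a b p q y"
  shows "profile_on (\<lambda>s. h (- s)) m (- b) (- a) (\<lambda>s. p (- s)) (\<lambda>s. - q (- s)) (\<lambda>s. y (- s))"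
proof -
  have c: "continuous_on {- b..- a} (\<lambda>s. f (- s))" if "continuous_on {a..b} f" for f :: "real \<Rightarrow> real"
    by (rule continuous_on_compose2[OF that]) (auto intro!: continuous_intros)
  have d: "((\<lambda>s. f (- s)) has_real_derivative - d) (at s)"
    if "(f has_real_derivative d) (at (- s))" for f :: "real \<Rightarrow> real" and s d
    using that by (simp add: DERIV_mirror)
  have sub: "- s \<in> {a..b}" if "s \<in> {- b..- a}" for s using that by auto
  have sub': "- s \<in> {a<..<b}" if "s \<in> {- b<..<- a}" for s using that by auto
  show ?thesis
  proof (rule profile_onI)
    show "continuous_on {- b..- a} (\<lambda>s. p (- s))" "continuous_on {- b..- a} (\<lambda>s. - q (- s))"
      "continuous_on {- b..- a} (\<lambda>s. y (- s))"
      by (intro c continuous_on_minus profile_onD(1-3)[OF prof])+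
  next
    fix s assume s: "s \<in> {- b<..<- a}"
    show "((\<lambda>s. y (- s)) has_real_derivative - q (- s)) (at s)"
      by (rule d[OF profile_onD(6)[OF prof sub'[OF s]]])
    assume y: "y (- s) \<noteq> 0"
    show "((\<lambda>s. p (- s)) has_real_derivative
        - (- q (- s)) * (m * p (- s) / y (- s) - h (- s))) (at s)"
      using d[OF profile_onD(7)[OF prof sub'[OF s] y]] by simp
    show "((\<lambda>s. - q (- s)) has_real_derivative p (- s) * (m * p (- s) / y (- s) - h (- s))) (at s)"
      using DERIV_minus[OF d[OF profile_onD(8)[OF prof sub'[OF s] y]]] by simp
  next
    fix s assume s: "s \<in> {- b..- a}"
    show "(p (- s))\<^sup>2 + (- q (- s))\<^sup>2 = 1" using profile_onD(4)[OF prof sub[OF s]] by simp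
    show "p (- s) = 0" if "y (- s) = 0" using profile_onD(5)[OF prof sub[OF s] that] .
  qed
qed

text \<open>Neither piece says anything about derivatives at \<open>b\<close>. For \<open>y\<close>
  the right-hand side \<open>q\<close> is continuous on the whole interval, so \<open>b\<close> is
  removable. The right-hand sides for \<open>p\<close> and \<open>q\<close> are continuous only off
  the axis, so there the argument is confined to a small interval \<open>{u..v}\<close> on which
  \<open>y\<close> has no zero.\<close>

lemma profile_on_glue:
  assumes 1: "profile_on h m a b p q y" and 2: "profile_on h m b c p q y"
    and "a \<le> b" "b \<le> c" and h: "continuous_on {a..c} h"
  shows "profile_on h m a c p q y"
proof -
  have ac: "{a..c} = {a..b} \<union> {b..c}" using \<open>a \<le> b\<close> \<open>b \<le> c\<close> by auto
  have cont: "continuous_on {a..c} f" if "continuous_on {a..b} f" "continuous_on {b..c} f"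
    for f :: "real \<Rightarrow> real"
    unfolding ac by (rule continuous_on_closed_Un[OF _ _ that]) auto
  have cp: "continuous_on {a..c} p" and cq: "continuous_on {a..c} q" and cy: "continuous_on {a..c} y"
    by (intro cont profile_onD(1-3)[OF 1] profile_onD(1-3)[OF 2])+
  have inner: "s \<in> {a<..<b} \<or> s \<in> {b<..<c}" if "s \<in> {a<..<c} - {b}" for s
    using that by auto
  have y': "(y has_real_derivative q s) (at s)" if "s \<in> {a<..<c}" for s
    by (rule has_real_derivative_removable[of "{b}", OF _ cy cq _ that])
      (use inner profile_onD(6)[OF 1] profile_onD(6)[OF 2] in blast)+
  have pq': "(p has_real_derivative - q s * (m * p s / y s - h s)) (at s) \<and>
    (q has_real_derivative p s * (m * p s / y s - h s)) (at s)"
    if s: "s \<in> {a<..<c}" "y s \<noteq> 0" for s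
  proof -
    have "isCont y s" using y'[OF s(1)] DERIV_isCont by blast
    then obtain d where d: "d > 0" "\<And>t. dist s t < d \<Longrightarrow> y t \<noteq> 0"
      using continuous_at_avoid[of s y 0] s(2) by blast
    define u v where "u = max a (s - d / 2)" and "v = min c (s + d / 2)"
    have uv: "{u..v} \<subseteq> {a..c}" "s \<in> {u<..<v}" using d(1) s by (auto simp: u_def v_def)
    have nz: "y t \<noteq> 0" if "t \<in> {u..v}" for t
      using that d(1) by (intro d(2)) (auto simp: u_def v_def dist_real_def)
    have inner': "(t \<in> {a<..<b} \<or> t \<in> {b<..<c}) \<and> t \<in> {u..v}" if "t \<in> {u<..<v} - {b}" for t
      using that inner by (auto simp: u_def v_def)
    have cuv: "continuous_on {u..v} p" "continuous_on {u..v} q" "continuous_on {u..v} y"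
      "continuous_on {u..v} h"
      using cp cq cy h uv(1) by (auto intro: continuous_on_subset)
    note d = has_real_derivative_removable[of "{b}" u v, OF _ _ _ _ uv(2)]
    show ?thesis
    proof (rule conjI; rule d)
      show "continuous_on {u..v} (\<lambda>s. - q s * (m * p s / y s - h s))"
        "continuous_on {u..v} (\<lambda>s. p s * (m * p s / y s - h s))"
        using nz by (intro continuous_intros cuv; blast)+
    qed (use cuv inner' nz profile_onD(7,8)[OF 1] profile_onD(7,8)[OF 2] in blast)+
  qed
  show ?thesis
  proof (rule profile_onI[OF cp cq cy])
    show "(p s)\<^sup>2 + (q s)\<^sup>2 = 1" if "s \<in> {a..c}" for s
      using that profile_onD(4)[OF 1] profile_onD(4)[OF 2] unfolding ac by blast
    show "p s = 0" if "s \<in> {a..c}" "y s = 0" for s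
      using that profile_onD(5)[OF 1] profile_onD(5)[OF 2] unfolding ac by blast
  qed (use y' pq' in blast)+
qed

section \<open>Local existence\<close>

lemma integral_diff_bound:
  fixes f g :: "real \<Rightarrow> real"
  assumes "a \<le> b" "continuous_on {a..b} f" "continuous_on {a..b} g"
    and "\<And>t. t \<in> {a..b} \<Longrightarrow> \<bar>f t - g t\<bar> \<le> B"
  shows "\<bar>integral {a..b} f - integral {a..b} g\<bar> \<le> B * (b - a)"
proof -
  have "norm (integral {a..b} (\<lambda>t. f t - g t)) \<le> B * (b - a)"
    using assms by (intro integral_bound continuous_intros) auto
  then show ?thesis
    using assms by (simp add: integral_diff integrable_continuous_real)
qed

lemma abs_sin_diff_le: "\<bar>sin x - sin y\<bar> \<le> \<bar>x - y\<bar>" for x y :: real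
  using field_differentiable_bound[of UNIV sin cos 1 x y] by (simp add: DERIV_sin)

lemma abs_cos_diff_le: "\<bar>cos x - cos y\<bar> \<le> \<bar>x - y\<bar>" for x y :: real
  using abs_sin_diff_le[of "pi / 2 - x" "pi / 2 - y"] by (simp add: sin_diff)

text \<open>With \<open>p = cos f\<close> and \<open>q = sin f\<close> the circle constraint holds
  automatically, and the equations for \<open>p\<close> and \<open>q\<close> reduce to the single
  equation \<open>f' = W f\<close>, in which \<open>y\<close> is the integral
  \<open>Y f\<close>.\<close>

lemma profile_on_regular:
  assumes h: "continuous_on UNIV h" and m: "m \<ge> 1" and y0: "y0 \<noteq> 0" and pq0: "p0\<^sup>2 + q0\<^sup>2 = 1"
  obtains c p q y where "b < c" "profile_on h m b c p q y" "p b = p0" "q b = q0" "y b = y0"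
proof -
  obtain t0 where t0: "p0 = cos t0" "q0 = sin t0" using sincos_total_2pi[OF pq0] by blast
  \<comment> \<open>Since \<open>y\<close> has slope at most 1 in absolute value, it stays at
    distance \<open>r\<close> from the axis for a length \<open>r\<close>. There \<open>W\<close>
    has Lipschitz constant \<open>2 * m / r\<close>, one half from the cosine and one from
    \<open>Y\<close>; the length \<open>d\<close> turns this into the factor 1/2.\<close>
  define r where "r = \<bar>y0\<bar> / 2"
  define d where "d = r / (4 * m)"
  define c where "c = b + d"
  have r: "r > 0" using y0 by (simp add: r_def)
  have d: "d > 0" "d \<le> r" "d * m = r / 4" using r m by (auto simp: d_def field_simps)
  define Y where "Y f s = y0 + integral {b..s} (\<lambda>t. sin (f t))" for f s
  define W where "W f s = m * cos (f s) / Y f s - h s" for f s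
  define T where "T f s = t0 + integral {b..s} (W f)" for f s
  have h': "continuous_on A h" for A using h continuous_on_subset by blast
  have contY: "continuous_on {b..c} (Y f)" if "continuous_on {b..c} f" for f
    unfolding Y_def using that
    by (intro continuous_intros indefinite_integral_continuous_1 integrable_continuous_real)
  have Y_ge: "\<bar>Y f s\<bar> \<ge> r" if f: "continuous_on {b..c} f" and s: "s \<in> {b..c}" for f s
  proof -
    have "norm (integral {b..s} (\<lambda>t. sin (f t))) \<le> 1 * (s - b)"
      using s by (intro integral_bound continuous_intros continuous_on_subset[OF f]) auto
    then have "\<bar>integral {b..s} (\<lambda>t. sin (f t))\<bar> \<le> r" using s d by (simp add: c_def)
    then show ?thesis unfolding Y_def r_def by linarith
  qed
  have Y_nz: "Y f s \<noteq> 0" if "continuous_on {b..c} f" "s \<in> {b..c}" for f s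
    using Y_ge[OF that] r by auto
  have contW: "continuous_on {b..c} (W f)" if "continuous_on {b..c} f" for f
    unfolding W_def using that contY[OF that] h' Y_nz[OF that] by (intro continuous_intros) auto
  have contT: "continuous_on {b..c} (T f)" if "continuous_on {b..c} f" for f
    unfolding T_def using contW[OF that]
    by (intro continuous_intros indefinite_integral_continuous_1 integrable_continuous_real)
  have contr: "norm (T f s - T g s) \<le> M / 2"
    if f: "continuous_on {b..c} f" and g: "continuous_on {b..c} g"
      and M: "\<And>t. t \<in> {b..c} \<Longrightarrow> norm (f t - g t) \<le> M" and s: "s \<in> {b..c}" for f g M s
  proof -
    have M0: "M \<ge> 0" using M[OF s] by (meson norm_ge_zero order_trans)
    have "\<bar>W f t - W g t\<bar> \<le> m * (2 * M / r)" if t: "t \<in> {b..c}" for t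
    proof -
      have "\<bar>integral {b..t} (\<lambda>t. sin (f t)) - integral {b..t} (\<lambda>t. sin (g t))\<bar> \<le> M * (t - b)"
      proof (rule integral_diff_bound)
        show "continuous_on {b..t} (\<lambda>t. sin (f t))" "continuous_on {b..t} (\<lambda>t. sin (g t))"
          using t by (auto intro!: continuous_on_sin continuous_on_subset[OF f] continuous_on_subset[OF g])
        show "\<bar>sin (f u) - sin (g u)\<bar> \<le> M" if "u \<in> {b..t}" for u
          using that t M[of u] abs_sin_diff_le[of "f u" "g u"] by auto
      qed (use t in auto)
      then have "\<bar>Y f t - Y g t\<bar> \<le> M * (t - b)" by (simp add: Y_def)
      also have "\<dots> \<le> M * r" using t d M0 by (intro mult_left_mono) (auto simp: c_def)
      finally have Yd: "\<bar>Y f t - Y g t\<bar> \<le> M * r" .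
      have nz: "Y f t \<noteq> 0" "Y g t \<noteq> 0" using Y_nz f g t by auto
      have ge: "\<bar>Y f t\<bar> \<ge> r" "\<bar>Y g t\<bar> \<ge> r" using Y_ge f g t by auto
      have cd: "\<bar>cos (f t) - cos (g t)\<bar> \<le> M"
        using M[OF t] abs_cos_diff_le[of "f t" "g t"] by simp
      have 1: "\<bar>(cos (f t) - cos (g t)) / Y f t\<bar> \<le> M / r"
        unfolding abs_divide using cd ge r by (intro frac_le) auto
      have "\<bar>cos (g t) * (Y g t - Y f t)\<bar> \<le> 1 * (M * r)"
        unfolding abs_mult using Yd by (intro mult_mono) (auto simp: abs_minus_commute)
      then have 2: "\<bar>cos (g t) * (Y g t - Y f t) / (Y f t * Y g t)\<bar> \<le> 1 * (M * r) / (r * r)"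
        unfolding abs_divide abs_mult[of "Y f t"] using ge r M0 by (intro frac_le mult_mono) auto
      have "W f t - W g t = m * ((cos (f t) - cos (g t)) / Y f t
          + cos (g t) * (Y g t - Y f t) / (Y f t * Y g t))"
        using nz by (simp add: W_def field_simps)
      moreover have "\<bar>(cos (f t) - cos (g t)) / Y f t
          + cos (g t) * (Y g t - Y f t) / (Y f t * Y g t)\<bar> \<le> 2 * M / r"
      proof -
        have "1 * (M * r) / (r * r) = M / r" using r by simp
        from order_trans[OF abs_triangle_ineq add_mono[OF 1 2[unfolded this]]]
        show ?thesis by simp
      qed
      ultimately show ?thesis by (simp add: abs_mult mult_left_mono del: times_divide_eq_right)
    qed
    then have "\<bar>integral {b..s} (W f) - integral {b..s} (W g)\<bar> \<le> m * (2 * M / r) * (s - b)"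
      using s contW[OF f] contW[OF g]
      by (intro integral_diff_bound) (auto intro: continuous_on_subset)
    also have "\<dots> \<le> m * (2 * M / r) * d"
      using s r M0 by (intro mult_left_mono) (auto simp: c_def)
    also have "\<dots> = 2 * M / r * (d * m)" by simp
    also have "\<dots> = M / 2" unfolding d(3) using r by simp
    finally show ?thesis by (simp add: T_def)
  qed
  obtain f where f: "continuous_on {b..c} f" and fixed: "\<And>s. s \<in> {b..c} \<Longrightarrow> T f s = f s"
    by (rule uniform_contraction_fixpoint[of "{b..c}" UNIV "\<lambda>_. 0" T])
      (use contT contr in \<open>auto intro: continuous_on_const\<close>)
  have f': "(f has_real_derivative W f s) (at s)" if s: "s \<in> {b<..<c}" for s
  proof -
    have "(T f has_real_derivative W f s) (at s)"
      unfolding T_def using integral_has_real_derivative_interior[OF contW[OF f] s]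
      by (auto intro!: derivative_eq_intros)
    moreover have "\<forall>\<^sub>F t in nhds s. T f t = f t"
    proof -
      have "\<forall>\<^sub>F t in nhds s. t \<in> {b<..<c}" using s by (intro eventually_nhds_in_open) auto
      then show ?thesis by (rule eventually_mono) (use fixed in auto)
    qed
    ultimately show ?thesis using DERIV_cong_ev[OF refl _ refl] by blast
  qed
  show thesis
  proof (rule that)
    show "b < c" using d by (simp add: c_def)
    show "profile_on h m b c (\<lambda>s. cos (f s)) (\<lambda>s. sin (f s)) (Y f)"
    proof (rule profile_onI)
      show "continuous_on {b..c} (\<lambda>s. cos (f s))" "continuous_on {b..c} (\<lambda>s. sin (f s))"
        using f by (auto intro: continuous_intros)
      show "continuous_on {b..c} (Y f)" using contY f by blast
      show "(Y f has_real_derivative sin (f s)) (at s)" if "s \<in> {b<..<c}" for s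
        unfolding Y_def
        using integral_has_real_derivative_interior[OF continuous_on_sin[OF f] that]
        by (auto intro!: derivative_eq_intros)
    next
      fix s assume "s \<in> {b<..<c}"
      from f'[OF this]
      show "((\<lambda>s. cos (f s)) has_real_derivative - sin (f s) * (m * cos (f s) / Y f s - h s)) (at s)"
        "((\<lambda>s. sin (f s)) has_real_derivative cos (f s) * (m * cos (f s) / Y f s - h s)) (at s)"
        by (auto intro!: derivative_eq_intros simp: W_def)
    qed (use Y_nz[OF f] in auto)
    have "f b = t0" using fixed[of b] d by (simp add: T_def c_def)
    then show "cos (f b) = p0" "sin (f b) = q0" "Y f b = y0" by (auto simp: t0 Y_def)
  qed
qed

section \<open>Initial values on the axis\<close>

text \<open>Because \<open>u2 / v2\<close> is at most 1, a change of the denominator costs no more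
  than its size relative to \<open>e\<close>. In the application both \<open>D\<close> and
  \<open>e\<close> are proportional to the distance from the axis point, so the bound does not blow
  up there.\<close>

lemma abs_ratio_diff_le:
  fixes u1 u2 v1 v2 :: real
  assumes "0 \<le> u2" "u2 \<le> v2" "e \<le> v1" "e \<le> v2" "0 < e" "\<bar>u1 - u2\<bar> \<le> D" "\<bar>v1 - v2\<bar> \<le> D"
  shows "\<bar>u1 / v1 - u2 / v2\<bar> \<le> 2 * D / e"
proof -
  have pos: "0 < v1" "0 < v2" "0 \<le> D" using assms by auto
  have "u1 / v1 - u2 / v2 = (u1 - u2) / v1 + (u2 / v2) * ((v2 - v1) / v1)"
    using pos by (simp add: field_simps)
  also have "\<bar>\<dots>\<bar> \<le> \<bar>(u1 - u2) / v1\<bar> + \<bar>(u2 / v2) * ((v2 - v1) / v1)\<bar>"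
    by (rule abs_triangle_ineq)
  also have "\<bar>(u1 - u2) / v1\<bar> \<le> D / e"
    unfolding abs_divide using assms pos by (intro frac_le) auto
  also have "\<bar>(u2 / v2) * ((v2 - v1) / v1)\<bar> \<le> 1 * (D / e)"
    unfolding abs_mult
  proof (rule mult_mono)
    show "\<bar>(v2 - v1) / v1\<bar> \<le> D / e"
      unfolding abs_divide using assms pos by (intro frac_le) (auto simp: abs_minus_commute)
  qed (use assms pos in auto)
  finally show ?thesis by simp
qed

text \<open>Difference of squares: the two roots differ by \<open>(b - a) * (b + a)\<close> divided
  by their sum, where \<bar>a + b\<bar> is at most 1 and the sum of the roots at least 1.\<close>

lemma abs_sqrt_one_minus_square_diff_le:
  fixes a b :: real
  assumes "\<bar>a\<bar> \<le> 1 / 2" "\<bar>b\<bar> \<le> 1 / 2"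
  shows "\<bar>sqrt (1 - a\<^sup>2) - sqrt (1 - b\<^sup>2)\<bar> \<le> \<bar>a - b\<bar>"
proof -
  have sq: "x\<^sup>2 \<le> (1/2)\<^sup>2" if "\<bar>x\<bar> \<le> 1 / 2" for x :: real
    using that by (simp add: abs_le_square_iff[symmetric])
  have ge: "sqrt (1 - x\<^sup>2) \<ge> 1 / 2" if "\<bar>x\<bar> \<le> 1 / 2" for x :: real
    using sq[OF that] by (intro real_le_rsqrt) (simp add: power2_eq_square)
  let ?u = "sqrt (1 - a\<^sup>2)" and ?v = "sqrt (1 - b\<^sup>2)"
  have "?u\<^sup>2 = 1 - a\<^sup>2" "?v\<^sup>2 = 1 - b\<^sup>2"
    using sq[OF assms(1)] sq[OF assms(2)] by (simp_all add: power2_eq_square)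
  then have "(?u - ?v) * (?u + ?v) = (b - a) * (b + a)"
    by (simp add: algebra_simps power2_eq_square)
  moreover have "\<bar>?u - ?v\<bar> * (?u + ?v) = \<bar>(?u - ?v) * (?u + ?v)\<bar>"
    using ge[OF assms(1)] ge[OF assms(2)] by (simp add: abs_mult)
  ultimately have "\<bar>?u - ?v\<bar> * (?u + ?v) = \<bar>a - b\<bar> * \<bar>a + b\<bar>"
    by (simp add: abs_mult abs_minus_commute add.commute)
  also have "\<dots> \<le> \<bar>a - b\<bar> * 1" using assms by (intro mult_left_mono) auto
  finally have "\<bar>?u - ?v\<bar> * (?u + ?v) \<le> \<bar>a - b\<bar>" by simp
  moreover have "\<bar>?u - ?v\<bar> * 1 \<le> \<bar>?u - ?v\<bar> * (?u + ?v)"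
    using ge[OF assms(1)] ge[OF assms(2)] by (intro mult_left_mono) auto
  ultimately show ?thesis by simp
qed

lemma continuous_on_bound_real:
  fixes h :: "real \<Rightarrow> real"
  assumes "continuous_on {a..b} h"
  obtains K where "K \<ge> 1" "\<And>s. s \<in> {a..b} \<Longrightarrow> \<bar>h s\<bar> \<le> K"
proof -
  have "bounded (h ` {a..b})"
    using assms by (intro compact_imp_bounded compact_continuous_image) auto
  then obtain K where K: "\<forall>x\<in>h ` {a..b}. norm x \<le> K" unfolding bounded_iff by blast
  have "\<bar>h s\<bar> \<le> max 1 K" if "s \<in> {a..b}" for s
    using bspec[OF K imageI[OF that]] by simp
  then show thesis using that[of "max 1 K"] by simp
qed

text \<open>The sign \<open>\<sigma>\<close> selects the side to which the curve leaves the axis.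
  With \<open>y = \<sigma> * Z\<close> and \<open>q = \<sigma> * Q\<close> the powers of
  \<open>\<sigma>\<close> in \<open>y^m\<close> cancel, so one fixed-point equation with increasing
  \<open>Z\<close> serves both sides.\<close>

lemma profile_on_singular:
  assumes h: "continuous_on UNIV h" and m: "m \<ge> 1" and sg: "\<sigma>\<^sup>2 = 1"
  obtains c p q y where "b < c" "profile_on h m b c p q y" "p b = 0" "q b = \<sigma>" "y b = 0"
proof -
  have sg_abs: "\<bar>\<sigma>\<bar> = 1" using sg by (auto simp: power2_eq_1_iff)
  have h': "continuous_on A h" for A using h continuous_on_subset by blast
  obtain K where K: "K \<ge> 1" and K0: "\<And>s. s \<in> {b..b + 1} \<Longrightarrow> \<bar>h s\<bar> \<le> K"
    using continuous_on_bound_real[OF h'[of "{b..b + 1}"]] by blast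
  \<comment> \<open>\<open>K * (4 * m + 1)\<close> is the Lipschitz constant of the integrand:
    \<open>4 * m\<close> comes from the \<open>m\<close>-th power of the quotient of
    \<open>Z\<close> values, 1 from \<open>Q\<close>. The same \<open>d\<close> is at most 1, where
    \<open>K\<close> bounds \<open>h\<close>, and satisfies \<open>d * K \<le> 1 / 2\<close>, which
    keeps \<open>T\<close> inside \<open>B\<close>.\<close>
  define d where "d = 1 / (2 * K * (4 * m + 1))"
  define c where "c = b + d"
  have K_le: "K \<le> K * (4 * m + 1)" using K by simp
  then have d: "d > 0" "d * (K * (4 * m + 1)) = 1 / 2" using K by (auto simp: d_def)
  have "d * 1 \<le> d * (K * (4 * m + 1))" "d * K \<le> d * (K * (4 * m + 1))"
    using d(1) K K_le by (intro mult_left_mono; linarith)+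
  then have d': "d \<le> 1" "d * K \<le> 1 / 2" unfolding d(2) by auto
  have hK: "\<bar>h s\<bar> \<le> K" if "s \<in> {b..c}" for s
    using K0[of s] that d' by (auto simp: c_def)
  define Q where "Q f s = sqrt (1 - (f s)\<^sup>2)" for f :: "real \<Rightarrow> real" and s
  define Z where "Z f s = integral {b..s} (Q f)" for f s
  define T where "T f s = integral {b..s} (\<lambda>t. \<sigma> * h t * Z f t ^ m * Q f t) / Z f s ^ m" for f s
  \<comment> \<open>The radius 1/2 keeps \<open>Q\<close> at least 1/2. So \<open>Q\<close> depends
    on \<open>f\<close> with Lipschitz constant 1, and \<open>Z\<close> grows at least like half the
    distance to \<open>b\<close>.\<close>
  define B where "B = {- 1 / 2..1 / 2 :: real}"
  have absB: "\<bar>f s\<bar> \<le> 1 / 2" if "f ` {b..c} \<subseteq> B" "s \<in> {b..c}" for f s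
    using that by (force simp: B_def abs_le_iff)
  have Q_ge: "Q f s \<ge> 1 / 2" if "f ` {b..c} \<subseteq> B" "s \<in> {b..c}" for f s
  proof -
    have "(f s)\<^sup>2 \<le> (1 / 2)\<^sup>2" using absB[OF that] by (simp add: abs_le_square_iff[symmetric])
    then show ?thesis unfolding Q_def by (intro real_le_rsqrt) (simp add: power2_eq_square)
  qed
  have Q_le: "Q f s \<le> 1" for f s by (simp add: Q_def)
  have contQ: "continuous_on {b..c} (Q f)" if "continuous_on {b..c} f" for f
    unfolding Q_def using that by (intro continuous_intros)
  have contZ: "continuous_on {b..c} (Z f)" if "continuous_on {b..c} f" for f
    unfolding Z_def using contQ[OF that]
    by (intro indefinite_integral_continuous_1 integrable_continuous_real)
  have Z_diff: "Z f s - Z f t \<ge> (s - t) / 2" "Z f s - Z f t \<le> s - t"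
    if f: "continuous_on {b..c} f" "f ` {b..c} \<subseteq> B" and st: "b \<le> t" "t \<le> s" "s \<le> c" for f s t
  proof -
    have sub: "{t..s} \<subseteq> {b..c}" "{b..s} \<subseteq> {b..c}" using st by auto
    have int: "Q f integrable_on {b..s}" "Q f integrable_on {t..s}"
      using contQ[OF f(1)] sub by (auto intro!: integrable_continuous_real intro: continuous_on_subset)
    have eq: "Z f s - Z f t = integral {t..s} (Q f)"
      unfolding Z_def using Henstock_Kurzweil_Integration.integral_combine[OF st(1,2) int(1)] by simp
    have "integral {t..s} (\<lambda>_. 1 / 2) \<le> integral {t..s} (Q f)"
      using Q_ge[OF f(2)] sub int by (intro integral_le) auto
    then show "Z f s - Z f t \<ge> (s - t) / 2" unfolding eq using st by simp
    have "integral {t..s} (Q f) \<le> integral {t..s} (\<lambda>_. 1)"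
      using Q_le int by (intro integral_le) auto
    then show "Z f s - Z f t \<le> s - t" unfolding eq using st by simp
  qed
  have Zb: "Z f b = 0" for f by (simp add: Z_def)
  \<comment> \<open>Division by zero gives \<open>T f b = 0 / 0 = 0\<close>, which is also the limit of \<open>T f\<close> at \<open>b\<close>.\<close>
  have Tb: "T f b = 0" for f by (simp add: T_def)
  have Z_ge: "Z f s \<ge> (s - b) / 2" and Z_le: "Z f s \<le> s - b"
    if "continuous_on {b..c} f" "f ` {b..c} \<subseteq> B" "s \<in> {b..c}" for f s
    using Z_diff[OF that(1,2), of b s] that(3) Zb[of f] by auto
  have Z_pos: "Z f s > 0" if "continuous_on {b..c} f" "f ` {b..c} \<subseteq> B" "s \<in> {b<..c}" for f s
    using Z_ge[OF that(1,2), of s] that(3) by auto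
  have ratio: "0 \<le> Z f t / Z f s \<and> Z f t / Z f s \<le> 1"
    if f: "continuous_on {b..c} f" "f ` {b..c} \<subseteq> B" and st: "b \<le> t" "t \<le> s" "s \<le> c" "b < s" for f s t
  proof -
    have "0 \<le> Z f t" "Z f t \<le> Z f s" "0 < Z f s"
      using Z_ge[OF f, of t] Z_diff(1)[OF f st(1-3)] Z_pos[OF f, of s] st by auto
    then show ?thesis by simp
  qed
  \<comment> \<open>Moving the denominator of \<open>T\<close> under the integral leaves powers of
    \<open>Z f t / Z f s\<close>, which lies in the unit interval; the singularity is gone from all
    estimates below.\<close>
  define V where "V f s t = \<sigma> * h t * (Z f t / Z f s) ^ m * Q f t" for f s t
  have T_eq: "T f s = integral {b..s} (V f s)" for f s
    unfolding T_def V_def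
    by (subst integral_divide[symmetric]) (simp add: power_divide mult_ac)
  have contV: "continuous_on {b..c} (V f s)" if "continuous_on {b..c} f" for f s
  proof (cases "Z f s = 0")
    case False
    then show ?thesis unfolding V_def
      using contZ[OF that] contQ[OF that] h' by (intro continuous_intros) auto
  next
    \<comment> \<open>Division by zero makes every quotient 0 here, and \<open>m \<ge> 1\<close>
      makes its \<open>m\<close>-th power vanish, so \<open>V f s\<close> is the zero
      function.\<close>
    case True
    then show ?thesis using m by (simp add: V_def[abs_def] power_0_left)
  qed
  have V_le: "\<bar>V f s t\<bar> \<le> K"
    if f: "continuous_on {b..c} f" "f ` {b..c} \<subseteq> B" and st: "b \<le> t" "t \<le> s" "s \<le> c" "b < s" for f s t
  proof -
    have "\<bar>V f s t\<bar> = \<bar>h t\<bar> * (\<bar>Z f t / Z f s\<bar> ^ m * \<bar>Q f t\<bar>)"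
      by (simp add: V_def abs_mult sg_abs power_abs)
    also have "\<dots> \<le> K * (1 * 1)"
      using hK[of t] ratio[OF f st] st Q_le[of f t] Q_ge[OF f(2), of t] K
      by (intro mult_mono power_le_one) auto
    finally show ?thesis by simp
  qed
  have T_le: "\<bar>T f s\<bar> \<le> K * (s - b)"
    if f: "continuous_on {b..c} f" "f ` {b..c} \<subseteq> B" and s: "s \<in> {b..c}" for f s
  proof (cases "s = b")
    case True
    then show ?thesis by (simp add: Tb)
  next
    case False
    have "norm (integral {b..s} (V f s)) \<le> K * (s - b)"
      using V_le[OF f] False s
      by (intro integral_bound continuous_on_subset[OF contV[OF f(1)]]) auto
    then show ?thesis by (simp add: T_eq)
  qed
  have contT: "continuous_on {b..c} (T f)"
    if f: "continuous_on {b..c} f" "f ` {b..c} \<subseteq> B" for f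
    unfolding continuous_on_eq_continuous_within
  proof
    fix s assume s: "s \<in> {b..c}"
    have contN: "continuous_on {b..c} (\<lambda>s. integral {b..s} (\<lambda>t. \<sigma> * h t * Z f t ^ m * Q f t))"
      using contZ[OF f(1)] contQ[OF f(1)] h'
      by (intro indefinite_integral_continuous_1 integrable_continuous_real continuous_intros)
    show "continuous (at s within {b..c}) (T f)"
    proof (cases "s = b")
      \<comment> \<open>The denominator of \<open>T f\<close> vanishes at \<open>b\<close>, so
        continuity there comes from squeezing by \<open>T_le\<close>.\<close>
      case True
      have "((\<lambda>t. K * (t - b)) \<longlongrightarrow> 0) (at b within {b..c})"
        by (auto intro!: tendsto_eq_intros)
      then have "(T f \<longlongrightarrow> 0) (at b within {b..c})"
        by (rule Lim_null_comparison[rotated])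
          (use T_le[OF f] in \<open>auto simp: eventually_at_filter\<close>)
      then show ?thesis by (simp add: continuous_within True Tb)
    next
      case False
      have "Z f s \<noteq> 0" using Z_pos[OF f, of s] s False by auto
      then show ?thesis
        unfolding T_def using contN contZ[OF f(1)] s
        by (intro continuous_intros) (auto simp: continuous_on_eq_continuous_within)
    qed
  qed
  have mapsT: "T f ` {b..c} \<subseteq> B" if f: "continuous_on {b..c} f" "f ` {b..c} \<subseteq> B" for f
  proof -
    have "\<bar>T f s\<bar> \<le> 1 / 2" if s: "s \<in> {b..c}" for s
    proof -
      have "K * (s - b) \<le> K * d" using s K by (intro mult_left_mono) (auto simp: c_def)
      then show ?thesis using T_le[OF f s] d' by (simp add: mult.commute)
    qed
    then show ?thesis by (force simp: B_def abs_le_iff)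
  qed
  have contr: "norm (T f s - T g s) \<le> M / 2"
    if f: "continuous_on {b..c} f" "f ` {b..c} \<subseteq> B" and g: "continuous_on {b..c} g" "g ` {b..c} \<subseteq> B"
      and M: "\<And>t. t \<in> {b..c} \<Longrightarrow> norm (f t - g t) \<le> M" and s: "s \<in> {b..c}" for f g M s
  proof (cases "s = b")
    case True
    have "M \<ge> 0" using M[OF s] by (meson norm_ge_zero order_trans)
    then show ?thesis by (simp add: True Tb)
  next
    case False
    have M0: "M \<ge> 0" using M[OF s] by (meson norm_ge_zero order_trans)
    have Qd: "\<bar>Q f t - Q g t\<bar> \<le> M" if "t \<in> {b..c}" for t
      unfolding Q_def using M[OF that]
        abs_sqrt_one_minus_square_diff_le[OF absB[OF f(2) that] absB[OF g(2) that]] by simp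
    have Zd: "\<bar>Z f t - Z g t\<bar> \<le> M * (s - b)" if "t \<in> {b..s}" for t
    proof -
      have "\<bar>Z f t - Z g t\<bar> \<le> M * (t - b)"
        unfolding Z_def using that s Qd
        by (intro integral_diff_bound continuous_on_subset[OF contQ[OF f(1)]]
            continuous_on_subset[OF contQ[OF g(1)]]) auto
      also have "\<dots> \<le> M * (s - b)" using that M0 by (intro mult_left_mono) auto
      finally show ?thesis .
    qed
    have "\<bar>V f s t - V g s t\<bar> \<le> K * (4 * m + 1) * M" if t: "t \<in> {b..s}" for t
    proof -
      have tc: "t \<in> {b..c}" using t s by auto
      let ?u = "Z f t / Z f s" and ?v = "Z g t / Z g s"
      have u: "0 \<le> ?u" "?u \<le> 1" using ratio[OF f, of t s] t s False by auto
      have v: "0 \<le> ?v" "?v \<le> 1" using ratio[OF g, of t s] t s False by auto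
      have "\<bar>?u - ?v\<bar> \<le> 2 * (M * (s - b)) / ((s - b) / 2)"
      proof (rule abs_ratio_diff_le)
        show "0 \<le> Z g t" "Z g t \<le> Z g s"
          using Z_ge[OF g tc] Z_diff(1)[OF g, of t s] t s by auto
        show "(s - b) / 2 \<le> Z f s" "(s - b) / 2 \<le> Z g s" using Z_ge[OF f s] Z_ge[OF g s] .
      qed (use Zd t s False in auto)
      also have "\<dots> = 4 * M" using s False by simp
      finally have uv: "\<bar>?u - ?v\<bar> \<le> 4 * M" .
      have "\<bar>?u ^ m - ?v ^ m\<bar> \<le> m * \<bar>?u - ?v\<bar>"
        using norm_power_diff[of ?u ?v m] u v by simp
      also have "\<dots> \<le> m * (4 * M)" using uv by (intro mult_left_mono) auto
      finally have pow: "\<bar>?u ^ m - ?v ^ m\<bar> \<le> m * (4 * M)" .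
      have "V f s t - V g s t = \<sigma> * h t * ((?u ^ m - ?v ^ m) * Q f t + ?v ^ m * (Q f t - Q g t))"
        by (simp add: V_def algebra_simps)
      then have "\<bar>V f s t - V g s t\<bar>
          = \<bar>h t\<bar> * \<bar>(?u ^ m - ?v ^ m) * Q f t + ?v ^ m * (Q f t - Q g t)\<bar>"
        by (simp add: abs_mult sg_abs)
      also have "\<dots> \<le> K * (m * (4 * M) * 1 + 1 * M)"
      proof (rule mult_mono)
        have "\<bar>(?u ^ m - ?v ^ m) * Q f t\<bar> \<le> m * (4 * M) * 1"
          unfolding abs_mult using pow Q_le[of f t] Q_ge[OF f(2) tc] M0 by (intro mult_mono) auto
        moreover have "\<bar>?v ^ m * (Q f t - Q g t)\<bar> \<le> 1 * M"
          unfolding abs_mult using v Qd[OF tc] by (intro mult_mono) (auto simp: power_le_one)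
        ultimately show "\<bar>(?u ^ m - ?v ^ m) * Q f t + ?v ^ m * (Q f t - Q g t)\<bar>
            \<le> m * (4 * M) * 1 + 1 * M" by linarith
      qed (use hK[OF tc] K in auto)
      finally show ?thesis by (simp add: algebra_simps)
    qed
    then have "\<bar>T f s - T g s\<bar> \<le> K * (4 * m + 1) * M * (s - b)"
      unfolding T_eq using s
      by (intro integral_diff_bound continuous_on_subset[OF contV[OF f(1)]]
          continuous_on_subset[OF contV[OF g(1)]]) auto
    also have "\<dots> \<le> K * (4 * m + 1) * M * d"
      using s K M0 by (intro mult_left_mono) (auto simp: c_def)
    also have "\<dots> = d * (K * (4 * m + 1)) * M" by simp
    also have "\<dots> = M / 2" unfolding d(2) by simp
    finally show ?thesis by simp
  qed
  obtain f where f: "continuous_on {b..c} f" "f ` {b..c} \<subseteq> B"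
    and fixed: "\<And>s. s \<in> {b..c} \<Longrightarrow> T f s = f s"
    by (rule uniform_contraction_fixpoint[of "{b..c}" B "\<lambda>_. 0" T])
      (use contT mapsT contr in \<open>auto simp: B_def\<close>)
  have Z': "(Z f has_real_derivative Q f s) (at s)" if "s \<in> {b<..<c}" for s
    unfolding Z_def using integral_has_real_derivative_interior[OF contQ[OF f(1)] that] .
  have f': "(f has_real_derivative Q f s * (\<sigma> * h s - m * f s / Z f s)) (at s)"
    if s: "s \<in> {b<..<c}" for s
  proof -
    \<comment> \<open>The fixed-point equation says \<open>N = f * Z^m\<close>. The quotient rule,
      with this value of \<open>N\<close> inserted, gives back the differential equation for
      \<open>p\<close>.\<close>
    define N where "N s = integral {b..s} (\<lambda>t. \<sigma> * h t * Z f t ^ m * Q f t)" for s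
    have N': "(N has_real_derivative \<sigma> * h s * Z f s ^ m * Q f s) (at s)"
      unfolding N_def using contZ[OF f(1)] contQ[OF f(1)] h' s
      by (intro integral_has_real_derivative_interior continuous_intros)
    have Zs: "Z f s > 0" using Z_pos[OF f, of s] s by auto
    have ev: "\<forall>\<^sub>F t in nhds s. N t / Z f t ^ m = f t"
    proof -
      have "\<forall>\<^sub>F t in nhds s. t \<in> {b<..<c}" using s by (intro eventually_nhds_in_open) auto
      then show ?thesis by (rule eventually_mono) (use fixed in \<open>auto simp: T_def N_def\<close>)
    qed
    from eventually_nhds_x_imp_x[OF this] have Ns: "N s = f s * Z f s ^ m"
      using Zs by (simp add: field_simps)
    obtain k where k: "m = Suc k" using m by (cases m) auto
    have "((\<lambda>t. N t / Z f t ^ m) has_real_derivative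
        ((\<sigma> * h s * Z f s ^ m * Q f s) * Z f s ^ m - N s * (m * Q f s * Z f s ^ (m - 1)))
          / (Z f s ^ m * Z f s ^ m)) (at s)"
      using Zs by (auto intro!: derivative_eq_intros N' Z' s simp: mult_ac)
    also have "((\<sigma> * h s * Z f s ^ m * Q f s) * Z f s ^ m - N s * (m * Q f s * Z f s ^ (m - 1)))
          / (Z f s ^ m * Z f s ^ m) = Q f s * (\<sigma> * h s - m * f s / Z f s)"
      unfolding Ns k using Zs by (simp add: field_simps)
    finally show ?thesis using DERIV_cong_ev[OF refl ev refl] by blast
  qed
  have sg_cases: "\<sigma> = 1 \<or> \<sigma> = - 1" using sg by (simp add: power2_eq_1_iff)
  show thesis
  proof (rule that)
    show "b < c" using d by (simp add: c_def)
    show "profile_on h m b c f (\<lambda>s. \<sigma> * Q f s) (\<lambda>s. \<sigma> * Z f s)"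
    proof (rule profile_onI)
      show "continuous_on {b..c} f" "continuous_on {b..c} (\<lambda>s. \<sigma> * Q f s)"
        "continuous_on {b..c} (\<lambda>s. \<sigma> * Z f s)"
        using f contQ contZ by (auto intro!: continuous_intros)
      show "((\<lambda>s. \<sigma> * Z f s) has_real_derivative \<sigma> * Q f s) (at s)" if "s \<in> {b<..<c}" for s
        using DERIV_cmult[OF Z'[OF that]] .
    next
      fix s assume s: "s \<in> {b..c}"
      have "(f s)\<^sup>2 \<le> 1" using absB[OF f(2) s] by (simp add: abs_square_le_1)
      then show "(f s)\<^sup>2 + (\<sigma> * Q f s)\<^sup>2 = 1" by (simp add: Q_def power_mult_distrib sg)
      assume "\<sigma> * Z f s = 0"
      then have "s = b" using sg_cases Z_pos[OF f, of s] s by force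
      then show "f s = 0" using fixed[OF s] Tb by simp
    next
      fix s assume s: "s \<in> {b<..<c}"
      then have sc: "s \<in> {b..c}" by auto
      have Qs: "Q f s > 0" using Q_ge[OF f(2) sc] by simp
      have Zs: "Z f s > 0" using Z_pos[OF f, of s] s by auto
      have "Q f s * (\<sigma> * h s - m * f s / Z f s) = - (\<sigma> * Q f s) * (m * f s / (\<sigma> * Z f s) - h s)"
        using Zs sg_cases by (elim disjE) (simp_all add: field_simps)
      with f'[OF s] show "(f has_real_derivative
          - (\<sigma> * Q f s) * (m * f s / (\<sigma> * Z f s) - h s)) (at s)" by simp
      \<comment> \<open>The equation for \<open>q\<close> is a consequence of the one for
        \<open>p\<close>: it arises by differentiating the square root, which is positive on this
        interval.\<close>
      define D where "D = Q f s * (\<sigma> * h s - m * f s / Z f s)"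
      have "((\<lambda>s. \<sigma> * sqrt (1 - (f s)\<^sup>2)) has_real_derivative
          \<sigma> * (- f s * D / sqrt (1 - (f s)\<^sup>2))) (at s)"
        using Qs f'[OF s, folded D_def] unfolding Q_def
        by (auto intro!: derivative_eq_intros simp: field_simps)
      then have "((\<lambda>s. \<sigma> * Q f s) has_real_derivative \<sigma> * (- f s * D / Q f s)) (at s)"
        by (simp add: Q_def)
      also have "\<sigma> * (- f s * D / Q f s) = f s * (m * f s / (\<sigma> * Z f s) - h s)"
        using Zs Qs sg_cases unfolding D_def by (elim disjE) (simp_all add: field_simps)
      finally show "((\<lambda>s. \<sigma> * Q f s) has_real_derivative
          f s * (m * f s / (\<sigma> * Z f s) - h s)) (at s)" .
    qed
    show "f b = 0" using fixed[of b] Tb d by (simp add: c_def)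
    then show "\<sigma> * Q f b = \<sigma>" "\<sigma> * Z f b = 0" by (simp_all add: Q_def Zb)
  qed
qed

section \<open>Behaviour at a finite end point\<close>

text \<open>A bounded derivative makes \<open>f\<close> Lipschitz, hence uniformly continuous, and
  such a function extends continuously to the closure.\<close>

lemma bounded_derivative_limit_at_left:
  fixes f f' :: "real \<Rightarrow> real"
  assumes "a < b" and der: "\<And>s. s \<in> {a<..<b} \<Longrightarrow> (f has_real_derivative f' s) (at s)"
    and bound: "\<And>s. s \<in> {a<..<b} \<Longrightarrow> \<bar>f' s\<bar> \<le> B"
  obtains l where "(f \<longlongrightarrow> l) (at_left b)"
proof -
  define C where "C = max B 1"
  have C: "C > 0" by (simp add: C_def)
  have lip: "\<bar>f s - f t\<bar> \<le> C * \<bar>s - t\<bar>" if "s \<in> {a<..<b}" "t \<in> {a<..<b}" for s t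
  proof -
    have "norm (f s - f t) \<le> C * norm (s - t)"
    proof (rule field_differentiable_bound)
      show "(f has_real_derivative f' u) (at u within {a<..<b})" "norm (f' u) \<le> C"
        if "u \<in> {a<..<b}" for u
        using der[OF that] bound[OF that] by (auto simp: C_def intro: has_field_derivative_at_within)
    qed (use that in auto)
    then show ?thesis by simp
  qed
  have "uniformly_continuous_on {a<..<b} f"
    unfolding uniformly_continuous_on_def
  proof (intro allI impI)
    fix e :: real assume "e > 0"
    have "dist (f t) (f s) < e"
      if "s \<in> {a<..<b}" "t \<in> {a<..<b}" "dist t s < e / C" for s t
    proof -
      have "C * \<bar>t - s\<bar> < e"
        using that(3) C by (simp add: dist_real_def field_simps)
      then show ?thesis using lip[OF that(2,1)] by (simp add: dist_real_def)
    qed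
    moreover have "e / C > 0" using \<open>e > 0\<close> C by simp
    ultimately show "\<exists>d>0. \<forall>x\<in>{a<..<b}. \<forall>x'\<in>{a<..<b}. dist x' x < d \<longrightarrow> dist (f x') (f x) < e"
      by blast
  qed
  moreover have "b \<in> closure {a<..<b}" using \<open>a < b\<close> by simp
  ultimately obtain l where "(f \<longlongrightarrow> l) (at b within {a<..<b})"
    using uniformly_continuous_on_extension_at_closure by blast
  moreover have "at b within {a<..<b} = at_left b"
    using \<open>a < b\<close> by (intro at_within_nhd[of b "{a<..}"]) auto
  ultimately show thesis using that by simp
qed

lemma continuous_on_fun_upd_limit:
  fixes f :: "real \<Rightarrow> real"
  assumes "a < b" and cont: "\<And>c. a \<le> c \<Longrightarrow> c < b \<Longrightarrow> continuous_on {a..c} f"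
    and lim: "(f \<longlongrightarrow> l) (at_left b)"
  shows "continuous_on {a..b} (f(b := l))"
proof -
  have eq: "((f(b := l)) \<longlongrightarrow> k) (at x within A) = (f \<longlongrightarrow> k) (at x within A)"
    if "x < b" for x k A
    using that by (intro filterlim_cong refl) (auto simp: eventually_at dist_real_def intro!: exI[of _ "b - x"])
  show ?thesis
  proof (rule continuous_on_IccI)
    define c where "c = (a + b) / 2"
    have "a < c" "c < b" using \<open>a < b\<close> by (auto simp: c_def)
    then show "((f(b := l)) \<longlongrightarrow> (f(b := l)) a) (at_right a)"
      using continuous_on_Icc_at_rightD[OF cont[of c]] \<open>a < b\<close> by (simp add: eq del: fun_upd_apply)
        (simp)
    show "((f(b := l)) \<longlongrightarrow> (f(b := l)) b) (at_left b)"
    proof -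
      have "((f(b := l)) \<longlongrightarrow> l) (at_left b)"
        using lim by (rule Lim_transform_eventually) (auto simp: eventually_at_filter)
      then show ?thesis by simp
    qed
  next
    fix x assume x: "a < x" "x < b"
    define c where "c = (x + b) / 2"
    have "x < c" "c < b" using x by (auto simp: c_def)
    then have "isCont f x"
      using continuous_on_interior[OF cont[of c], of x] x by (simp add: interior_atLeastAtMost_real)
    then show "(f(b := l)) \<midarrow>x\<rightarrow> (f(b := l)) x"
      using x by (simp add: eq isCont_def del: fun_upd_apply) simp
  qed fact
qed

text \<open>At a zero of \<open>f\<close> the difference quotient of the product is that of
  \<open>f\<close> times \<open>g\<close>, so continuity of \<open>g\<close> suffices. This is
  applied to \<open>y * q\<close> at zeros of \<open>y\<close>.\<close>

lemma has_real_derivative_mult_at_zero: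
  fixes f g :: "real \<Rightarrow> real"
  assumes "(f has_real_derivative d) (at s)" "f s = 0" "isCont g s"
  shows "((\<lambda>t. f t * g t) has_real_derivative d * g s) (at s)"
proof -
  have "((\<lambda>t. (f t - f s) / (t - s) * g t) \<longlongrightarrow> d * g s) (at s)"
    using assms by (intro tendsto_mult) (auto simp: has_field_derivative_iff isCont_def)
  then show ?thesis by (simp add: has_field_derivative_iff assms(2))
qed

lemma constant_sign_on_interval:
  fixes f :: "real \<Rightarrow> real"
  assumes cont: "continuous_on {a<..<b} f" and nz: "\<And>s. s \<in> {a<..<b} \<Longrightarrow> f s \<noteq> 0"
  obtains \<sigma> where "\<sigma> = 1 \<or> \<sigma> = - 1" "\<And>s. s \<in> {a<..<b} \<Longrightarrow> f s = \<sigma> * \<bar>f s\<bar>"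
proof -
  have sub: "{u..v} \<subseteq> f ` {a<..<b}" if "u \<in> f ` {a<..<b}" "v \<in> f ` {a<..<b}" for u v
    using connected_continuous_image[OF cont connected_Ioo] that by (rule connected_contains_Icc)
  show thesis
  proof (cases "\<exists>s\<in>{a<..<b}. f s < 0")
    case True
    then obtain s where s: "s \<in> {a<..<b}" "f s < 0" by blast
    have "f t < 0" if t: "t \<in> {a<..<b}" for t
    proof (rule ccontr)
      assume "\<not> f t < 0"
      then have "0 \<in> {f s..f t}" using s by auto
      then show False using sub[OF imageI[OF s(1)] imageI[OF t]] nz by auto
    qed
    then show thesis using that[of "- 1"] by force
  next
    case False
    then show thesis using that[of 1] nz by force
  qed
qed

lemma profile_on_closure:
  assumes "a < b" and prof: "\<And>c. a \<le> c \<Longrightarrow> c < b \<Longrightarrow> profile_on h m a c p q y"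
    and lim: "(p \<longlongrightarrow> pb) (at_left b)" "(q \<longlongrightarrow> qb) (at_left b)" "(y \<longlongrightarrow> yb) (at_left b)"
    and zero: "yb = 0 \<Longrightarrow> pb = 0"
  shows "profile_on h m a b (p(b := pb)) (q(b := qb)) (y(b := yb))"
proof (rule profile_onI)
  show "continuous_on {a..b} (p(b := pb))" "continuous_on {a..b} (q(b := qb))"
    "continuous_on {a..b} (y(b := yb))"
    by (rule continuous_on_fun_upd_limit[OF \<open>a < b\<close> _ lim(1)]
        continuous_on_fun_upd_limit[OF \<open>a < b\<close> _ lim(2)]
        continuous_on_fun_upd_limit[OF \<open>a < b\<close> _ lim(3)], rule profile_onD[OF prof]; assumption)+
next
  have unit: "(p s)\<^sup>2 + (q s)\<^sup>2 = 1" if "s \<in> {a..<b}" for s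
    using profile_onD(4)[OF prof, of s s] that by simp
  fix s assume s: "s \<in> {a..b}"
  have "pb\<^sup>2 + qb\<^sup>2 = 1"
  proof (rule tendsto_unique)
    show "((\<lambda>s. (p s)\<^sup>2 + (q s)\<^sup>2) \<longlongrightarrow> pb\<^sup>2 + qb\<^sup>2) (at_left b)"
      by (intro tendsto_intros lim)
    have "\<forall>\<^sub>F s in at_left b. s \<in> {a<..<b}" using \<open>a < b\<close> by (rule eventually_at_leftI[rotated])
    then show "((\<lambda>s. (p s)\<^sup>2 + (q s)\<^sup>2) \<longlongrightarrow> 1) (at_left b)"
      by (intro tendsto_eventually) (auto elim!: eventually_mono intro!: unit)
  qed simp
  then show "((p(b := pb)) s)\<^sup>2 + ((q(b := qb)) s)\<^sup>2 = 1" using unit s by auto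
  show "(p(b := pb)) s = 0" if "(y(b := yb)) s = 0"
    using that zero s profile_onD(5)[OF prof, of s s] by (cases "s = b") auto
next
  fix s assume s: "s \<in> {a<..<b}"
  define c where "c = (s + b) / 2"
  have c: "a \<le> c" "c < b" "s \<in> {a<..<c}" using s by (auto simp: c_def)
  have *: "profile_on h m a c (p(b := pb)) (q(b := qb)) (y(b := yb))"
    by (rule profile_on_cong[OF prof[OF c(1,2)]]) (use c in auto)
  show "(y(b := yb) has_real_derivative (q(b := qb)) s) (at s)"
    by (rule profile_onD(6)[OF * c(3)])
  assume y: "(y(b := yb)) s \<noteq> 0"
  show "(p(b := pb) has_real_derivative - (q(b := qb)) s *
      (real m * (p(b := pb)) s / (y(b := yb)) s - h s)) (at s)"
    by (rule profile_onD(7)[OF * c(3) y])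
  show "(q(b := qb) has_real_derivative (p(b := pb)) s *
      (real m * (p(b := pb)) s / (y(b := yb)) s - h s)) (at s)"
    by (rule profile_onD(8)[OF * c(3) y])
qed

lemma abs_le_1_if_unit:
  fixes p q :: real
  assumes "p\<^sup>2 + q\<^sup>2 = 1"
  shows "\<bar>p\<bar> \<le> 1" "\<bar>q\<bar> \<le> 1"
proof -
  have "p\<^sup>2 \<le> 1" "q\<^sup>2 \<le> 1" using assms zero_le_power2[of p] zero_le_power2[of q] by linarith+
  then show "\<bar>p\<bar> \<le> 1" "\<bar>q\<bar> \<le> 1" by (simp_all add: abs_square_le_1)
qed

text \<open>Near \<open>b\<close> the modulus of \<open>y\<close> exceeds half that of its limit, so
  \<open>p\<close> and \<open>q\<close> have derivatives bounded by
  \<open>m / r + K\<close>.\<close>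

lemma profile_limit_off_axis:
  assumes h: "continuous_on UNIV h" and "a < b"
    and prof: "\<And>c. a \<le> c \<Longrightarrow> c < b \<Longrightarrow> profile_on h m a c p q y"
    and lim: "(y \<longlongrightarrow> yb) (at_left b)" and yb: "yb \<noteq> 0"
  obtains pb qb where "(p \<longlongrightarrow> pb) (at_left b)" "(q \<longlongrightarrow> qb) (at_left b)"
proof -
  obtain K where K: "K \<ge> 1" "\<And>s. s \<in> {a..b} \<Longrightarrow> \<bar>h s\<bar> \<le> K"
    using continuous_on_bound_real continuous_on_subset[OF h] by blast
  define r where "r = \<bar>yb\<bar> / 2"
  have r: "r > 0" "r < \<bar>yb\<bar>" using yb by (auto simp: r_def)
  have "\<forall>\<^sub>F s in at_left b. \<bar>y s\<bar> > r"
    using order_tendstoD(1)[OF tendsto_rabs[OF lim] r(2)] .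
  then obtain s2 where s2: "s2 < b" "\<And>s. s2 < s \<Longrightarrow> s < b \<Longrightarrow> \<bar>y s\<bar> > r"
    unfolding eventually_at_left_field by blast
  define e where "e = max a s2"
  have e: "e < b" using \<open>a < b\<close> s2 by (simp add: e_def)
  have bounds: "\<bar>p s\<bar> \<le> 1 \<and> \<bar>q s\<bar> \<le> 1 \<and> \<bar>m * p s / y s - h s\<bar> \<le> m / r + K \<and> y s \<noteq> 0"
    if s: "s \<in> {e<..<b}" for s
  proof -
    have ys: "\<bar>y s\<bar> > r" using s2 s by (simp add: e_def)
    have pq: "\<bar>p s\<bar> \<le> 1" "\<bar>q s\<bar> \<le> 1"
      using abs_le_1_if_unit[OF profile_onD(4)[OF prof, of s s]] s by (auto simp: e_def)
    have "\<bar>m * p s / y s\<bar> \<le> m / r"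
      unfolding abs_divide abs_mult using pq ys r by (intro frac_le) (auto intro: mult_left_le)
    moreover have "\<bar>h s\<bar> \<le> K" using K(2)[of s] s by (auto simp: e_def)
    ultimately show ?thesis using pq ys r by (auto intro: order_trans[OF abs_triangle_ineq4])
  qed
  have der: "(p has_real_derivative - q s * (m * p s / y s - h s)) (at s)"
    "(q has_real_derivative p s * (m * p s / y s - h s)) (at s)" if s: "s \<in> {e<..<b}" for s
    using profile_onD(7,8)[OF prof[of "(s + b) / 2"], of s] bounds[OF s] s by (auto simp: e_def)
  have "\<bar>- q s * (m * p s / y s - h s)\<bar> \<le> 1 * (m / r + K)" if "s \<in> {e<..<b}" for s
    unfolding abs_mult using bounds[OF that] by (intro mult_mono) auto
  from bounded_derivative_limit_at_left[OF e der(1) this]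
  obtain pb where pb: "(p \<longlongrightarrow> pb) (at_left b)" by blast
  have "\<bar>p s * (m * p s / y s - h s)\<bar> \<le> 1 * (m / r + K)" if "s \<in> {e<..<b}" for s
    unfolding abs_mult using bounds[OF that] by (intro mult_mono) auto
  from bounded_derivative_limit_at_left[OF e der(2) this]
  obtain qb where "(q \<longlongrightarrow> qb) (at_left b)" by blast
  with pb that show thesis by blast
qed

text \<open>The derivative of \<open>y * q\<close> is given by \<open>D\<close> everywhere: off the
  axis by the equations, and at zeros of \<open>y\<close> because \<open>p = 0\<close> there. The
  lower bound for \<open>D\<close> uses \<open>m \<ge> 1\<close> to compare
  \<open>q^2 + m p^2\<close> with 1. The resulting estimate determines \<open>q\<close> only up to
  sign, so the sign is shown to be constant near \<open>b\<close>.\<close>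

lemma profile_limit_on_axis:
  assumes h: "continuous_on UNIV h" and m: "m \<ge> 1" and "a < b"
    and prof: "\<And>c. a \<le> c \<Longrightarrow> c < b \<Longrightarrow> profile_on h m a c p q y"
    and lim: "(y \<longlongrightarrow> 0) (at_left b)"
  obtains \<sigma> where "(p \<longlongrightarrow> 0) (at_left b)" "(q \<longlongrightarrow> \<sigma>) (at_left b)"
proof -
  obtain K where K: "K \<ge> 1" "\<And>s. s \<in> {a..b} \<Longrightarrow> \<bar>h s\<bar> \<le> K"
    using continuous_on_bound_real continuous_on_subset[OF h] by blast
  have cont: "continuous_on {a..c} p" "continuous_on {a..c} q" "continuous_on {a..c} y"
    if "a \<le> c" "c < b" for c
    using profile_onD(1-3)[OF prof[OF that]] by auto
  have unit: "(p s)\<^sup>2 + (q s)\<^sup>2 = 1" if "s \<in> {a..<b}" for s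
    using profile_onD(4)[OF prof, of s s] that by simp
  have pq1: "\<bar>p s\<bar> \<le> 1" "\<bar>q s\<bar> \<le> 1" if "s \<in> {a..<b}" for s
    using abs_le_1_if_unit[OF unit[OF that]] by auto
  have y': "(y has_real_derivative q s) (at s)" if "s \<in> {a<..<b}" for s
    using profile_onD(6)[OF prof[of "(s + b) / 2"], of s] that by auto
  have q': "(q has_real_derivative p s * (m * p s / y s - h s)) (at s)"
    if "s \<in> {a<..<b}" "y s \<noteq> 0" for s
    using profile_onD(8)[OF prof[of "(s + b) / 2"], of s] that by auto
  \<comment> \<open>The mean value theorem on \<open>{s..b}\<close>, with the limit 0 written in as
    value at \<open>b\<close>. It does the work of integrating up to \<open>b\<close>.\<close>
  have mean: "\<exists>t\<in>{s<..<b}. - f s = (b - s) * f' t"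
    if s: "s \<in> {a<..<b}" and f: "\<And>c. a \<le> c \<Longrightarrow> c < b \<Longrightarrow> continuous_on {a..c} f"
      "(f \<longlongrightarrow> 0) (at_left b)" "\<And>t. t \<in> {a<..<b} \<Longrightarrow> (f has_real_derivative f' t) (at t)"
    for s and f f' :: "real \<Rightarrow> real"
  proof -
    let ?g = "f(b := 0)"
    have "continuous_on {s..b} ?g"
      using continuous_on_fun_upd_limit[OF \<open>a < b\<close> f(1,2)] s by (auto intro: continuous_on_subset)
    moreover have g': "(?g has_real_derivative f' t) (at t)" if "s < t" "t < b" for t
    proof -
      have "\<forall>\<^sub>F u in nhds t. u \<in> {s<..<b}" using that by (intro eventually_nhds_in_open) auto
      then have "\<forall>\<^sub>F u in nhds t. ?g u = f u" by (rule eventually_mono) auto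
      moreover have "(f has_real_derivative f' t) (at t)" using f(3)[of t] s that by simp
      ultimately show ?thesis using DERIV_cong_ev[OF refl _ refl] by blast
    qed
    ultimately obtain l t where t: "s < t" "t < b" "(?g has_real_derivative l) (at t)"
      "?g b - ?g s = (b - s) * l"
      using MVT[of s b ?g] s by (auto simp: real_differentiable_def)
    then have "l = f' t" using g' DERIV_unique by blast
    then show ?thesis using t s by auto
  qed
  have y_le: "\<bar>y s\<bar> \<le> b - s" if s: "s \<in> {a<..<b}" for s
  proof -
    obtain t where t: "t \<in> {s<..<b}" "- y s = (b - s) * q t"
      using mean[OF s cont(3) lim y'] by blast
    have "\<bar>y s\<bar> = \<bar>- y s\<bar>" by simp
    also have "\<dots> = (b - s) * \<bar>q t\<bar>" unfolding t(2) abs_mult using s by simp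
    also have "\<dots> \<le> (b - s) * 1" using pq1[of t] t s by (intro mult_left_mono) auto
    finally show ?thesis by simp
  qed
  define D where "D s = (q s)\<^sup>2 + m * (p s)\<^sup>2 - h s * y s * p s" for s
  have E': "((\<lambda>s. y s * q s) has_real_derivative D s) (at s)" if s: "s \<in> {a<..<b}" for s
  proof (cases "y s = 0")
    case True
    have "p s = 0" using profile_onD(5)[OF prof, of s s] True s by auto
    moreover have "isCont q s"
      using continuous_on_interior[OF cont(2)[of "(s + b) / 2"], of s] s
      by (simp add: interior_atLeastAtMost_real)
    ultimately show ?thesis
      using has_real_derivative_mult_at_zero[OF y'[OF s] True, of q]
      by (simp add: D_def power2_eq_square True)
  next
    case False
    show ?thesis
      by (rule DERIV_cong[OF DERIV_mult[OF y'[OF s] q'[OF s False]]])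
        (use False in \<open>simp add: D_def field_simps power2_eq_square\<close>)
  qed
  have D_ge: "D s \<ge> 1 - K * (b - s)" if s: "s \<in> {a<..<b}" for s
  proof -
    have "\<bar>h s * y s * p s\<bar> \<le> K * (b - s) * 1"
      unfolding abs_mult using K(2)[of s] y_le[OF s] pq1[of s] s by (intro mult_mono) auto
    moreover have "1 * (p s)\<^sup>2 \<le> m * (p s)\<^sup>2" using m by (intro mult_right_mono) auto
    ultimately show ?thesis using unit[of s] s unfolding D_def by auto
  qed
  have E_le: "y s * q s \<le> - ((b - s) * (1 - K * (b - s)))" if s: "s \<in> {a<..<b}" for s
  proof -
    have "((\<lambda>s. y s * q s) \<longlongrightarrow> 0) (at_left b)"
    proof (rule Lim_null_comparison)
      show "((\<lambda>s. \<bar>y s\<bar>) \<longlongrightarrow> 0) (at_left b)" using tendsto_rabs[OF lim] by simp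
      have "norm (y s * q s) \<le> \<bar>y s\<bar>" if "s \<in> {a<..<b}" for s
        using pq1(2)[of s] that by (simp add: abs_mult mult_left_le)
      then show "\<forall>\<^sub>F s in at_left b. norm (y s * q s) \<le> \<bar>y s\<bar>"
        using \<open>a < b\<close> by (intro eventually_at_leftI) auto
    qed
    then obtain t where t: "t \<in> {s<..<b}" "- (y s * q s) = (b - s) * D t"
      using mean[OF s _ _ E'] cont continuous_on_mult by blast
    have "K * (b - t) \<le> K * (b - s)" using t K by (intro mult_left_mono) auto
    then have "(b - s) * (1 - K * (b - s)) \<le> (b - s) * D t"
      using D_ge[of t] t s by (intro mult_left_mono) auto
    then show ?thesis using t(2) by linarith
  qed
  \<comment> \<open>Beyond \<open>e\<close> the product \<open>K * (b - s)\<close> stays below 1/2,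
    which keeps \<open>q\<close> away from 0 and hence its sign constant.\<close>
  define e where "e = max a (b - 1 / (2 * K))"
  have e: "e < b" using \<open>a < b\<close> K by (simp add: e_def)
  have q_ge: "\<bar>q s\<bar> \<ge> 1 - K * (b - s)" if s: "s \<in> {a<..<b}" for s
  proof -
    have "(b - s) * (1 - K * (b - s)) \<le> \<bar>y s * q s\<bar>" using E_le[OF s] by simp
    also have "\<dots> \<le> (b - s) * \<bar>q s\<bar>"
      unfolding abs_mult using y_le[OF s] by (intro mult_right_mono) auto
    finally show ?thesis using s by simp
  qed
  have q_nz: "q s \<noteq> 0" if s: "s \<in> {e<..<b}" for s
  proof -
    have "K * (b - s) < K * (1 / (2 * K))" using s K by (intro mult_strict_left_mono) (auto simp: e_def)
    also have "\<dots> = 1 / 2" using K by simp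
    finally show ?thesis using q_ge[of s] s by (auto simp: e_def)
  qed
  have "continuous_on {e<..<b} q"
  proof (rule continuous_at_imp_continuous_on, rule ballI)
    fix s assume "s \<in> {e<..<b}"
    then show "isCont q s"
      using continuous_on_interior[OF cont(2)[of "(s + b) / 2"], of s]
      by (simp add: interior_atLeastAtMost_real e_def)
  qed
  from constant_sign_on_interval[OF this q_nz]
  obtain \<sigma> where \<sigma>: "\<sigma> = 1 \<or> \<sigma> = - 1" "\<And>s. s \<in> {e<..<b} \<Longrightarrow> q s = \<sigma> * \<bar>q s\<bar>" by blast
  have "((\<lambda>s. \<bar>q s\<bar>) \<longlongrightarrow> 1) (at_left b)"
  proof (rule tendsto_sandwich)
    show "((\<lambda>s. 1 - K * (b - s)) \<longlongrightarrow> 1) (at_left b)" by (auto intro!: tendsto_eq_intros)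
    show "((\<lambda>_. 1) \<longlongrightarrow> 1) (at_left b)" by simp
    show "\<forall>\<^sub>F s in at_left b. 1 - K * (b - s) \<le> \<bar>q s\<bar>"
      using \<open>a < b\<close> by (intro eventually_at_leftI q_ge)
    show "\<forall>\<^sub>F s in at_left b. \<bar>q s\<bar> \<le> 1"
      using \<open>a < b\<close> by (intro eventually_at_leftI[of a] pq1) auto
  qed
  then have abs_q: "((\<lambda>s. \<sigma> * \<bar>q s\<bar>) \<longlongrightarrow> \<sigma>) (at_left b)"
    using tendsto_mult_left[of _ 1 _ \<sigma>] by fastforce
  have "\<forall>\<^sub>F s in at_left b. \<sigma> * \<bar>q s\<bar> = q s"
    using e by (intro eventually_at_leftI[of e]) (simp_all add: \<sigma>(2)[symmetric])
  with abs_q have q: "(q \<longlongrightarrow> \<sigma>) (at_left b)" by (rule Lim_transform_eventually)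
  then have "((\<lambda>s. sqrt (1 - (q s)\<^sup>2)) \<longlongrightarrow> sqrt (1 - \<sigma>\<^sup>2)) (at_left b)"
    by (intro tendsto_intros)
  moreover have "\<forall>\<^sub>F s in at_left b. sqrt (1 - (q s)\<^sup>2) = \<bar>p s\<bar>"
  proof (rule eventually_at_leftI[OF _ \<open>a < b\<close>])
    fix s assume "s \<in> {a<..<b}"
    then have "1 - (q s)\<^sup>2 = (p s)\<^sup>2" using unit[of s] by simp
    then show "sqrt (1 - (q s)\<^sup>2) = \<bar>p s\<bar>" by simp
  qed
  ultimately have "((\<lambda>s. \<bar>p s\<bar>) \<longlongrightarrow> sqrt (1 - \<sigma>\<^sup>2)) (at_left b)" by (rule Lim_transform_eventually)
  moreover have "sqrt (1 - \<sigma>\<^sup>2) = 0" using \<sigma>(1) by auto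
  ultimately have "((\<lambda>s. \<bar>p s\<bar>) \<longlongrightarrow> 0) (at_left b)" by (rule back_subst[where P = "\<lambda>l. (_ \<longlongrightarrow> l) _"])
  then have "(p \<longlongrightarrow> 0) (at_left b)" by (rule tendsto_rabs_zero_cancel)
  with q show thesis by (rule that[rotated])
qed

lemma profile_on_limit:
  assumes h: "continuous_on UNIV h" and m: "m \<ge> 1" and "a < b"
    and prof: "\<And>c. a \<le> c \<Longrightarrow> c < b \<Longrightarrow> profile_on h m a c p q y"
  obtains pb qb yb where "profile_on h m a b (p(b := pb)) (q(b := qb)) (y(b := yb))"
proof -
  have y': "(y has_real_derivative q s) (at s)" if "s \<in> {a<..<b}" for s
    using profile_onD(6)[OF prof[of "(s + b) / 2"], of s] that by auto
  have q1: "\<bar>q s\<bar> \<le> 1" if "s \<in> {a<..<b}" for s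
    using abs_le_1_if_unit(2)[OF profile_onD(4)[OF prof, of s s]] that by auto
  obtain yb where yb: "(y \<longlongrightarrow> yb) (at_left b)"
    using bounded_derivative_limit_at_left[OF \<open>a < b\<close> y' q1] .
  obtain pb qb where pq: "(p \<longlongrightarrow> pb) (at_left b)" "(q \<longlongrightarrow> qb) (at_left b)" "yb = 0 \<Longrightarrow> pb = 0"
  proof (cases "yb = 0")
    case True
    with yb have "(y \<longlongrightarrow> 0) (at_left b)" by simp
    from profile_limit_on_axis[OF h m \<open>a < b\<close> prof this] that show thesis by blast
  next
    case False
    from profile_limit_off_axis[OF h \<open>a < b\<close> prof yb this] that False show thesis by blast
  qed
  from profile_on_closure[OF \<open>a < b\<close> prof pq(1,2) yb pq(3)] that show thesis by blast
qed

section \<open>Global existence\<close>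

lemma profile_on_extend:
  assumes h: "continuous_on UNIV h" and m: "m \<ge> 1" and "a \<le> b"
    and prof: "profile_on h m a b p q y"
  obtains c p' q' y' where "b < c" "profile_on h m a c p' q' y'"
    "\<And>s. s \<le> b \<Longrightarrow> p' s = p s \<and> q' s = q s \<and> y' s = y s"
proof -
  have unit: "(p b)\<^sup>2 + (q b)\<^sup>2 = 1" and zero: "y b = 0 \<Longrightarrow> p b = 0"
    using profile_onD(4,5)[OF prof, of b] \<open>a \<le> b\<close> by auto
  obtain c P Q Y where c: "b < c" and PQY: "profile_on h m b c P Q Y"
    and eq: "P b = p b" "Q b = q b" "Y b = y b"
  proof (cases "y b = 0")
    case True
    then have "(q b)\<^sup>2 = 1" using unit zero by simp
    from profile_on_singular[OF h m this, of b] zero True that show thesis by metis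
  next
    case False
    from profile_on_regular[OF h m this unit, of b] that show thesis by blast
  qed
  define p' q' y' where "p' s = (if s \<le> b then p s else P s)"
    and "q' s = (if s \<le> b then q s else Q s)" and "y' s = (if s \<le> b then y s else Y s)" for s
  have "profile_on h m a b p' q' y'"
    by (rule profile_on_cong[OF prof]) (auto simp: p'_def q'_def y'_def)
  moreover have "profile_on h m b c p' q' y'"
    by (rule profile_on_cong[OF PQY]) (use eq in \<open>auto simp: p'_def q'_def y'_def\<close>)
  ultimately have "profile_on h m a c p' q' y'"
    by (rule profile_on_glue) (use \<open>a \<le> b\<close> c continuous_on_subset[OF h] in auto)
  then show thesis using c that by (simp add: p'_def q'_def y'_def)
qed

lemma profile_on_half_line:
  assumes h: "continuous_on UNIV h" and m: "m \<ge> 1" and y0: "y0 \<noteq> 0" and unit: "p0\<^sup>2 + q0\<^sup>2 = 1"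
  obtains p q y where "p a = p0" "q a = q0" "y a = y0" "\<And>b. a \<le> b \<Longrightarrow> profile_on h m a b p q y"
proof -
  define R where "R b f = profile_on h m a b (\<lambda>s. fst (f s)) (\<lambda>s. fst (snd (f s))) (\<lambda>s. snd (snd (f s)))"
    for b and f :: "real \<Rightarrow> real \<times> real \<times> real"
  obtain f where f: "f a = (p0, q0, y0)" "\<And>b. a \<le> b \<Longrightarrow> R b f"
  proof (rule extension_to_half_line[of R a "\<lambda>_. (p0, q0, y0)"])
    show "R b g" if "R b f" "\<And>s. s \<in> {a..b} \<Longrightarrow> g s = f s" for b f g
      using that(1) unfolding R_def by (rule profile_on_cong) (simp_all add: that(2))
    show "R c f" if "R b f" "a \<le> c" "c \<le> b" for b c f
      using that unfolding R_def by (auto intro: profile_on_subset)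
    \<comment> \<open>The open interval from \<open>a\<close> to \<open>a\<close> is empty, so the
      differential equations hold vacuously.\<close>
    show "R a (\<lambda>_. (p0, q0, y0))"
      unfolding R_def by (rule profile_onI) (use y0 unit in auto)
    show "\<exists>c>b. \<exists>g. R c g \<and> (\<forall>s\<in>{a..b}. g s = f s)" if "a \<le> b" "R b f" for b f
    proof -
      obtain c p' q' y' where "b < c" "profile_on h m a c p' q' y'"
        "\<And>s. s \<le> b \<Longrightarrow> p' s = fst (f s) \<and> q' s = fst (snd (f s)) \<and> y' s = snd (snd (f s))"
        using profile_on_extend[OF h m \<open>a \<le> b\<close> \<open>R b f\<close>[unfolded R_def]] by blast
      then show ?thesis
        by (intro exI[of _ c] conjI exI[of _ "\<lambda>s. (p' s, q' s, y' s)"]) (auto simp: R_def)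
    qed
    show "\<exists>g. R b g \<and> (\<forall>s\<in>{a..<b}. g s = f s)"
      if "a < b" and below: "\<And>c. a \<le> c \<Longrightarrow> c < b \<Longrightarrow> R c f" for b f
    proof -
      let ?p = "\<lambda>s. fst (f s)" and ?q = "\<lambda>s. fst (snd (f s))" and ?y = "\<lambda>s. snd (snd (f s))"
      obtain pb qb yb where "profile_on h m a b (?p(b := pb)) (?q(b := qb)) (?y(b := yb))"
        using profile_on_limit[OF h m \<open>a < b\<close> below[unfolded R_def]] by blast
      then have "R b (f(b := (pb, qb, yb)))"
        unfolding R_def by (rule profile_on_cong) auto
      then show ?thesis by (intro exI[of _ "f(b := (pb, qb, yb))"]) auto
    qed
  qed blast
  show thesis by (rule that[OF _ _ _ f(2)[unfolded R_def]]) (simp_all add: f(1))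
qed

lemma profile_on_line:
  assumes h: "continuous_on UNIV h" and m: "m \<ge> 1" and y0: "y0 \<noteq> 0" and unit: "p0\<^sup>2 + q0\<^sup>2 = 1"
  obtains p q y where "p s0 = p0" "q s0 = q0" "y s0 = y0" "\<And>a b. profile_on h m a b p q y"
proof -
  obtain p q y where r: "p s0 = p0" "q s0 = q0" "y s0 = y0"
    and right: "\<And>b. s0 \<le> b \<Longrightarrow> profile_on h m s0 b p q y"
    using profile_on_half_line[OF h m y0 unit] by blast
  have h': "continuous_on UNIV (\<lambda>s. h (- s))"
    by (rule continuous_on_compose2[OF h]) (auto intro: continuous_intros)
  \<comment> \<open>This is the backward half, run forward from \<open>- s0\<close>; the reflection
    negates \<open>q\<close>, hence the initial value \<open>- q0\<close>.\<close>
  obtain P Q Y where l: "P (- s0) = p0" "Q (- s0) = - q0" "Y (- s0) = y0"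
    and left: "\<And>b. - s0 \<le> b \<Longrightarrow> profile_on (\<lambda>s. h (- s)) m (- s0) b P Q Y"
    using profile_on_half_line[OF h' m y0, of p0 "- q0" "- s0"] unit by auto
  define p' q' y' where "p' s = (if s0 \<le> s then p s else P (- s))"
    and "q' s = (if s0 \<le> s then q s else - Q (- s))" and "y' s = (if s0 \<le> s then y s else Y (- s))" for s
  have prof: "profile_on h m a b p' q' y'" for a b
  proof -
    \<comment> \<open>The interval is enlarged to contain \<open>s0\<close>, where the halves are
      glued, and cut back at the end.\<close>
    define u v where "u = min a s0" and "v = max b s0"
    have uv: "u \<le> s0" "s0 \<le> v" "u \<le> a" "b \<le> v" by (auto simp: u_def v_def)
    have "profile_on h m u s0 (\<lambda>s. P (- s)) (\<lambda>s. - Q (- s)) (\<lambda>s. Y (- s))"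
      using profile_on_reflect[OF left[of "- u"]] uv by simp
    then have "profile_on h m u s0 p' q' y'"
      by (rule profile_on_cong) (use r l in \<open>auto simp: p'_def q'_def y'_def\<close>)
    moreover have "profile_on h m s0 v p' q' y'"
      by (rule profile_on_cong[OF right[OF uv(2)]]) (auto simp: p'_def q'_def y'_def)
    ultimately have "profile_on h m u v p' q' y'"
      by (rule profile_on_glue) (use uv continuous_on_subset[OF h] in auto)
    then show ?thesis using uv(3,4) by (rule profile_on_subset)
  qed
  show thesis by (rule that[OF _ _ _ prof]) (simp_all add: p'_def q'_def y'_def r)
qed

section \<open>Recovering \<open>x\<close> and the curvature equation\<close>

text \<open>The integral over \<open>{a..s}\<close> is 0 for \<open>s < a\<close>, so it is no
  antiderivative to the left of \<open>a\<close>; one on the whole line is taken and shifted by a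
  constant.\<close>

lemma antiderivative_on_line:
  fixes f :: "real \<Rightarrow> real"
  assumes "continuous_on UNIV f"
  obtains F where "F a = 0" "\<And>s. (F has_real_derivative f s) (at s)"
proof -
  have "\<exists>F. \<forall>x::real. -\<infinity> < ereal x \<longrightarrow> ereal x < \<infinity> \<longrightarrow> (F has_vector_derivative f x) (at x)"
    using assms by (intro einterval_antiderivative) (auto simp: continuous_on_eq_continuous_at)
  then obtain F where "\<And>s. (F has_real_derivative f s) (at s)"
    by (auto simp: has_real_derivative_iff_has_vector_derivative)
  then show thesis
    by (intro that[of "\<lambda>s. F s - F a"]) (auto intro!: derivative_eq_intros)
qed

lemma C1_differentiable_onI_real:
  fixes f :: "real \<Rightarrow> real"
  assumes "\<And>s. s \<in> S \<Longrightarrow> (f has_real_derivative D s) (at s)" "continuous_on S D"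
  shows "f C1_differentiable_on S"
  using assms unfolding C1_differentiable_on_def has_real_derivative_iff_has_vector_derivative by blast

theorem theorem2p1:
  fixes n :: nat and H :: "real \<Rightarrow> real" and s0 c c' d' :: real
  assumes "n \<ge> 3"
    and "continuous_on UNIV H"
    and "c > 0"
    and "c'\<^sup>2 + d'\<^sup>2 = 1"
  shows "\<exists>x y. global_solution_curve n H x y \<and>
           x s0 = 0 \<and> y s0 = c \<and> deriv x s0 = c' \<and> deriv y s0 = d'"
proof -
  define m where "m = n - 2"
  define h where "h s = (real n - 1) * H s" for s
  have m: "m \<ge> 1" "real m = real n - 2" using \<open>n \<ge> 3\<close> by (auto simp: m_def)
  have h: "continuous_on UNIV h" unfolding h_def by (intro continuous_intros assms(2))
  obtain p q y where init: "p s0 = c'" "q s0 = d'" "y s0 = c"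
    and prof: "\<And>a b. profile_on h m a b p q y"
    using profile_on_line[OF h m(1) _ assms(4), of c s0] \<open>c > 0\<close> by auto
  \<comment> \<open>Every point is interior to some compact interval, so the equations imposed at
    interior points hold at every point of the line.\<close>
  have int: "s \<in> {s - 1<..<s + 1}" for s :: real by simp
  define w where "w s = m * p s / y s - h s" for s
  have unit: "(p s)\<^sup>2 + (q s)\<^sup>2 = 1" for s using profile_onD(4)[OF prof, of s s s] by simp
  have y': "(y has_real_derivative q s) (at s)" for s by (rule profile_onD(6)[OF prof int])
  have p': "(p has_real_derivative - q s * w s) (at s)" and q': "(q has_real_derivative p s * w s) (at s)"
    if "y s \<noteq> 0" for s
    using profile_onD(7,8)[OF prof int that] by (simp_all add: w_def)
  have line: "continuous_on UNIV f" if f: "\<And>a b. continuous_on {a..b} f" for f :: "real \<Rightarrow> real"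
  proof (rule continuous_at_imp_continuous_on, rule ballI)
    show "isCont f s" for s
      using continuous_on_interior[OF f[of "s - 1" "s + 1"], of s]
      by (simp add: interior_atLeastAtMost_real)
  qed
  have cont: "continuous_on S p" "continuous_on S q" "continuous_on S y" "continuous_on S h" for S
    using line[OF profile_onD(1)[OF prof]] line[OF profile_onD(2)[OF prof]]
      line[OF profile_onD(3)[OF prof]] h by (auto intro: continuous_on_subset)
  have cont_w: "continuous_on {s. y s \<noteq> 0} w"
    unfolding w_def by (intro continuous_intros cont) auto
  \<comment> \<open>The system for \<open>p\<close>, \<open>q\<close> and \<open>y\<close> does not
    involve \<open>x\<close>, which is therefore recovered by integration at the end.\<close>
  obtain x where x: "x s0 = 0" "\<And>s. (x has_real_derivative p s) (at s)"
    using antiderivative_on_line[OF cont(1)] by blast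
  have dx: "deriv x = p" and dy: "deriv y = q" using x(2) y' DERIV_imp_deriv by blast+
  have ddx: "deriv p s = - q s * w s" and ddy: "deriv q s = p s * w s" if "y s \<noteq> 0" for s
    using p'[OF that] q'[OF that] DERIV_imp_deriv by blast+
  have C1: "x C1_differentiable_on S" "y C1_differentiable_on S" for S
    by (rule C1_differentiable_onI_real, rule x(2) y', rule cont)+
  have "p C1_differentiable_on {s. y s \<noteq> 0}" "q C1_differentiable_on {s. y s \<noteq> 0}"
    using p' q' by (auto intro!: C1_differentiable_onI_real continuous_intros cont cont_w)
  then have C2: "x C2_differentiable_on {s. y s \<noteq> 0}" "y C2_differentiable_on {s. y s \<noteq> 0}"
    using C1 by (auto simp: C2_differentiable_on_def dx dy)
  have eq: "(real n - 1) * H s = (real n - 2) * (p s / y s) + deriv p s * q s - p s * deriv q s"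
    if "y s \<noteq> 0" for s
  proof -
    \<comment> \<open>\<open>w\<close> is the rate of rotation of the tangent, so on the unit circle
      the second-order terms of the curvature equation reduce to \<open>- w\<close>.\<close>
    have "deriv p s * q s - p s * deriv q s = - w s * ((p s)\<^sup>2 + (q s)\<^sup>2)"
      by (simp add: ddx[OF that] ddy[OF that] algebra_simps power2_eq_square)
    then show ?thesis by (simp add: unit w_def m(2) h_def)
  qed
  have "global_solution_curve n H x y"
    unfolding global_solution_curve_def dx dy using C1 C2 unit eq by blast
  then show ?thesis using x(1) init dx dy by blast
qed

end
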